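(* Let $n\ge 1$, $1\le d\le m-1$ be integers. Let $\mathcal{M}_0$ be a (non-empty) compact $\mathcal{C}^3$-manifold, $u\colon\mathcal{M}_0\to\mathbb{R}^n$ an immersion and $p\colon\mathcal{M}_0\to\mathcal{G}_d(\mathbb{R}^m)$ a continuous map. Let $E=\mathbb{R}^n\times M(\mathbb{R}^m)$, let $\check u\colon\mathcal{M}_0\to E$, $\check u(x_0)=(u(x_0),P_{p(x_0)})$, be the lifting map, and let $\check{\mathcal{M}}=\check u(\mathcal{M}_0)\subset E$ be the lift of $\mathcal{M}_0$. Suppose that $\check u$ is an embedding (a homeomorphism onto its image). Let $\gamma>0$, endow $E$ with the norm $\|\cdot\|_\gamma$, and consider the Čech bundle filtration of $\check{\mathcal{M}}$, consisting of the thickenings $(\check{\mathcal{M}}^t)_t$ and the maps $(p^t)_t$. Its maximal filtration value is $t^{\max}_\gamma(\check{\mathcal{M}})=\frac{\sqrt2}{2}\gamma$. Let $i_0^t\colon\check{\mathcal{M}}\to\check{\mathcal{M}}^t$ denote the inclusion. Let $t\ge0$ be such that $t<\min\big(\mathrm{reach}(\check{\mathcal{M}}),t^{\max}_\gamma(\check{\mathcal{M}})\big)$. Then the map $i_0^t\circ\check u\colon\mathcal{M}_0\to\check{\mathcal{M}}^t$ induces an isomorphism $H^*(\check{\mathcal{M}}^t)\to H^*(\mathcal{M}_0)$ which, for every $i\in\{1,\dots,d\}$, maps the $i$-th persistent Stiefel-Whitney class $w_i^t(\check{\mathcal{M}})$ at time $t$ of the Čech bundle filtration of $\check{\mathcal{M}}$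 to the $i$-th Stiefel-Whitney class of the vector bundle $(\mathcal{M}_0,p)$.
   Context: $H^*$ is singular cohomology with $\mathbb{Z}/2$ coefficients. $M(\mathbb{R}^m)$ is the space of real $m\times m$ matrices with Frobenius norm $\|\cdot\|_F$; $E=\mathbb{R}^n\times M(\mathbb{R}^m)$ carries the Euclidean norm $\|(x,A)\|_\gamma^2=\|x\|^2+\gamma^2\|A\|_F^2$. For a $d$-plane $V\subset\mathbb{R}^m$, $P_V$ is the matrix of the orthogonal projection onto $V$; the Grassmannian $\mathcal{G}_d(\mathbb{R}^m)$ is identified via $V\mapsto P_V$ with the set of rank-$d$ orthogonal projection matrices in $M(\mathbb{R}^m)$. Its medial axis $\mathrm{med}(\mathcal{G}_d(\mathbb{R}^m))$ is the set of matrices having at least two distinct nearest points (for $\|\cdot\|_F$) in $\mathcal{G}_d(\mathbb{R}^m)$; outside it, $\mathrm{proj}(\cdot,\mathcal{G}_d(\mathbb{R}^m))$ denotes the nearest-point projection. The reach of a closed subset of $(E,\|\cdot\|_\gamma)$ is the supremum of the $r\ge0$ such that every point at distance less than $r$ from the subset has a unique nearest point in it. For $X\subset E$ and $t\ge0$, $X^t=\{e\in E:\ \inf_{x\in X}\|e-x\|_\gamma\le t\}$. Set $t^{\max}_\gamma(X)=\gamma\cdot\inf\{\mathrm{dist}(A,\mathrm{med}(\mathcal{G}_d(\mathbb{R}^m))):\ (y,A)\in X\}$ (Frobenius distance). When $t^{\max}_\gamma(X)>0$, the Čech bundle filtration of $X$ is the family $(X^t)_{t\in T}$, $T=[0,t^{\max}_\gamma(X))$,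 with the continuous maps $p^t\colon X^t\to\mathcal{G}_d(\mathbb{R}^m)$, $p^t(x,A)=\mathrm{proj}(A,\mathcal{G}_d(\mathbb{R}^m))$; its maximal filtration value is $t^{\max}_\gamma(X)$. Let $w_i\in H^i(\mathcal{G}_d(\mathbb{R}^m))$ be the $i$-th Stiefel-Whitney class of the tautological bundle of $\mathcal{G}_d(\mathbb{R}^m)$. The $i$-th persistent Stiefel-Whitney class of $X$ at time $t\in T$ is $w_i^t(X)=(p^t)^*(w_i)\in H^i(X^t)$. The continuous map $p\colon\mathcal{M}_0\to\mathcal{G}_d(\mathbb{R}^m)$ is regarded as (a classifying map of) a $d$-dimensional vector bundle on $\mathcal{M}_0$, and the $i$-th Stiefel-Whitney class of $(\mathcal{M}_0,p)$ is $p^*(w_i)\in H^i(\mathcal{M}_0)$. *)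

theory Defs
  imports "HOL-Analysis.Analysis" "HOL-Homology.Homology" "HOL-Library.Z2"
begin

section \<open>Singular cohomology with coefficients in the field with two elements\<close>

text \<open>A singular cochain is a function on singular simplices. As in the homology library, everything
  is carved out of a fixed function type: a cochain vanishes off the singular simplices of the
  space.\<close>

type_synonym 'a cochain = "((nat \<Rightarrow> real) \<Rightarrow> 'a) \<Rightarrow> bit"

definition cochains :: "nat \<Rightarrow> 'a topology \<Rightarrow> 'a cochain set" where
  "cochains p X = {c. \<forall>f. \<not> singular_simplex p X f \<longrightarrow> c f = 0}"

text \<open>The signs in the coboundary are irrelevant modulo two.\<close>

definition coboundary :: "nat \<Rightarrow> 'a topology \<Rightarrow> 'a cochain \<Rightarrow> 'a cochain" where
  "coboundary p X c = (\<lambda>f. if singular_simplex (Suc p) X f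
     then \<Sum>k\<le>Suc p. c (singular_face (Suc p) k f) else 0)"

definition cocycle_group :: "nat \<Rightarrow> 'a topology \<Rightarrow> 'a cochain monoid" where
  "cocycle_group p X =
     \<lparr>carrier = {c \<in> cochains p X. coboundary p X c = (\<lambda>_. 0)},
      mult = (\<lambda>a b f. a f + b f),
      one = (\<lambda>_. 0)\<rparr>"

definition coboundaries :: "nat \<Rightarrow> 'a topology \<Rightarrow> 'a cochain set" where
  "coboundaries p X = (case p of 0 \<Rightarrow> {\<lambda>_. 0} | Suc q \<Rightarrow> coboundary q X ` cochains q X)"

text \<open>Cohomology groups are written multiplicatively, following the library's group theory: the
  group operation is addition of classes, and the unit of the group is the zero class.\<close>

definition cohomology_group :: "nat \<Rightarrow> 'a topology \<Rightarrow> 'a cochain set monoid" where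
  "cohomology_group p X = cocycle_group p X Mod coboundaries p X"

definition cohomology_class :: "nat \<Rightarrow> 'a topology \<Rightarrow> 'a cochain \<Rightarrow> 'a cochain set" where
  "cohomology_class p X c = coboundaries p X #>\<^bsub>cocycle_group p X\<^esub> c"

definition cochain_pullback ::
    "nat \<Rightarrow> 'a topology \<Rightarrow> ('a \<Rightarrow> 'b) \<Rightarrow> 'b cochain \<Rightarrow> 'a cochain" where
  "cochain_pullback p X g c =
     (\<lambda>f. if singular_simplex p X f then c (simplex_map p g f) else 0)"

text \<open>The map induced in cohomology by a continuous map \<open>g\<close> from \<open>X\<close> to some space \<open>Y\<close>, on classes
  of \<open>Y\<close>. Pullbacks of the representatives of one class all lie in one class of \<open>X\<close>, so the union
  below is a union of copies of that class; the same device is used for the cup product.\<close>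

definition cohomology_pullback ::
    "nat \<Rightarrow> 'a topology \<Rightarrow> ('a \<Rightarrow> 'b) \<Rightarrow> 'b cochain set \<Rightarrow> 'a cochain set" where
  "cohomology_pullback p X g w = (\<Union>c\<in>w. cohomology_class p X (cochain_pullback p X g c))"

text \<open>Alexander-Whitney formula: the front \<open>p\<close>-face of \<open>f\<close> and its back \<open>q\<close>-face, the latter being
  spanned by the vertices \<open>p, \<dots>, p + q\<close>.\<close>

definition cochain_cup ::
    "nat \<Rightarrow> nat \<Rightarrow> 'a topology \<Rightarrow> 'a cochain \<Rightarrow> 'a cochain \<Rightarrow> 'a cochain" where
  "cochain_cup p q X a b = (\<lambda>f. if singular_simplex (p + q) X f
     then a (restrict f (standard_simplex p)) *
          b (restrict (f \<circ> (\<lambda>x i. if i < p then 0 else x (i - p))) (standard_simplex q))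
     else 0)"

definition cup ::
    "nat \<Rightarrow> nat \<Rightarrow> 'a topology \<Rightarrow> 'a cochain set \<Rightarrow> 'a cochain set \<Rightarrow> 'a cochain set" where
  "cup p q X v w = (\<Union>a\<in>v. \<Union>b\<in>w. cohomology_class (p + q) X (cochain_cup p q X a b))"

definition cohomology_unit :: "'a topology \<Rightarrow> 'a cochain set" where
  "cohomology_unit X = cohomology_class 0 X (\<lambda>f. if singular_simplex 0 X f then 1 else 0)"

text \<open>Powers of a class of degree one.\<close>

primrec cup_power :: "'a topology \<Rightarrow> 'a cochain set \<Rightarrow> nat \<Rightarrow> 'a cochain set" where
  "cup_power X x 0 = cohomology_unit X"
| "cup_power X x (Suc j) = cup j 1 X (cup_power X x j) x"

text \<open>Isomorphisms of graded cohomology rings, given degree by degree.\<close>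

definition cohomology_iso ::
    "'b topology \<Rightarrow> 'a topology \<Rightarrow> (nat \<Rightarrow> 'b cochain set \<Rightarrow> 'a cochain set) \<Rightarrow> bool" where
  "cohomology_iso Y X F \<longleftrightarrow>
     (\<forall>p. F p \<in> iso (cohomology_group p Y) (cohomology_group p X)) \<and>
     F 0 (cohomology_unit Y) = cohomology_unit X \<and>
     (\<forall>p q. \<forall>v\<in>carrier (cohomology_group p Y). \<forall>w\<in>carrier (cohomology_group q Y).
        F (p + q) (cup p q Y v w) = cup p q X (F p v) (F q w))"


section \<open>Manifolds and immersions of class \<open>C\<^sup>3\<close>\<close>

text \<open>Points of \<open>k\<close>-dimensional space are the sequences in the library's \<open>Euclidean_space k\<close>, which
  vanish from index \<open>k\<close> on. This makes the dimension a natural number and admits dimension zero.\<close>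

definition partial_deriv ::
    "nat \<Rightarrow> ((nat \<Rightarrow> real) \<Rightarrow> 'b::real_normed_vector) \<Rightarrow> (nat \<Rightarrow> real) \<Rightarrow> 'b" where
  "partial_deriv i g x = vector_derivative (\<lambda>s. g (x(i := s))) (at (x i))"

text \<open>Class \<open>C\<^sup>r\<close> on an open subset \<open>W\<close> of \<open>Euclidean_space k\<close>: all iterated partial derivatives of
  order at most \<open>r\<close> exist and are continuous.\<close>

primrec C_on ::
    "nat \<Rightarrow> nat \<Rightarrow> ((nat \<Rightarrow> real) \<Rightarrow> 'b::real_normed_vector) \<Rightarrow> (nat \<Rightarrow> real) set \<Rightarrow> bool" where
  "C_on k 0 g W \<longleftrightarrow> continuous_map (subtopology (Euclidean_space k) W) euclidean g"
| "C_on k (Suc r) g W \<longleftrightarrow>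
     continuous_map (subtopology (Euclidean_space k) W) euclidean g \<and>
     (\<forall>i<k. (\<forall>x\<in>W. (\<lambda>s. g (x(i := s))) differentiable (at (x i))) \<and>
            C_on k r (partial_deriv i g) W)"

type_synonym 'a chart = "'a set \<times> ('a \<Rightarrow> nat \<Rightarrow> real)"

definition chart_on :: "'a topology \<Rightarrow> nat \<Rightarrow> 'a chart \<Rightarrow> bool" where
  "chart_on X k = (\<lambda>(U, \<phi>). openin X U \<and> openin (Euclidean_space k) (\<phi> ` U) \<and>
     homeomorphic_map (subtopology X U) (subtopology (Euclidean_space k) (\<phi> ` U)) \<phi>)"

definition C3_compatible :: "nat \<Rightarrow> 'a chart \<Rightarrow> 'a chart \<Rightarrow> bool" where
  "C3_compatible k = (\<lambda>(U, \<phi>) (V, \<psi>).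
     \<forall>j<k. C_on k 3 (\<lambda>y. \<psi> (inv_into U \<phi> y) j) (\<phi> ` (U \<inter> V)))"

text \<open>A compact manifold without boundary, of dimension \<open>k\<close>, with a (not necessarily maximal) atlas
  of class \<open>C\<^sup>3\<close>. Second countability follows from compactness.\<close>

definition compact_C3_manifold :: "'a topology \<Rightarrow> nat \<Rightarrow> 'a chart set \<Rightarrow> bool" where
  "compact_C3_manifold X k \<A> \<longleftrightarrow>
     compact_space X \<and> Hausdorff_space X \<and>
     (\<forall>c\<in>\<A>. chart_on X k c) \<and>
     (\<Union>c\<in>\<A>. fst c) = topspace X \<and>
     (\<forall>c\<in>\<A>. \<forall>c'\<in>\<A>. C3_compatible k c c')"

text \<open>In every chart, the map is of class \<open>C\<^sup>3\<close> with injective differential.\<close>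

definition C3_immersion :: "nat \<Rightarrow> 'a chart set \<Rightarrow> ('a \<Rightarrow> 'b::euclidean_space) \<Rightarrow> bool" where
  "C3_immersion k \<A> u \<longleftrightarrow> (\<forall>(U, \<phi>)\<in>\<A>.
     C_on k 3 (u \<circ> inv_into U \<phi>) (\<phi> ` U) \<and>
     (\<forall>y\<in>\<phi> ` U. inj_on (\<lambda>v. \<Sum>i<k. v i *\<^sub>R partial_deriv i (u \<circ> inv_into U \<phi>) y)
        (topspace (Euclidean_space k))))"


section \<open>The Grassmannian\<close>

definition orthogonal_projection_onto :: "real^'m^'m \<Rightarrow> (real^'m) set \<Rightarrow> bool" where
  "orthogonal_projection_onto P V \<longleftrightarrow>
     (\<forall>x. P *v x \<in> V \<and> (\<forall>v\<in>V. (x - P *v x) \<bullet> v = 0))"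

text \<open>A \<open>d\<close>-plane is identified with the matrix of the orthogonal projection onto it. The library
  norm on \<open>real^'m^'m\<close> is the Frobenius norm.\<close>

definition grassmannian :: "nat \<Rightarrow> (real^'m^'m) set" where
  "grassmannian d = {P. \<exists>V. subspace V \<and> dim V = d \<and> orthogonal_projection_onto P V}"

definition medial_axis :: "'a::metric_space set \<Rightarrow> 'a set" where
  "medial_axis S = {a. \<exists>P\<in>S. \<exists>Q\<in>S. P \<noteq> Q \<and>
     (\<forall>R\<in>S. dist a P \<le> dist a R) \<and> (\<forall>R\<in>S. dist a Q \<le> dist a R)}"


section \<open>Stiefel-Whitney classes of the tautological bundle\<close>

text \<open>The generator of the first cohomology group of the projective space of lines in \<open>\<real>\<^sup>m\<close>, which
  has exactly two elements for \<open>m \<ge> 2\<close>. It is the first Stiefel-Whitney class of the tautological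
  line bundle.\<close>

definition hyperplane_class :: "(real^'m^'m) cochain set" where
  "hyperplane_class =
     (let H = cohomology_group 1 (top_of_set (grassmannian 1)) in
      THE x. x \<in> carrier H \<and> x \<noteq> \<one>\<^bsub>H\<^esub>)"

text \<open>The projective bundle of the tautological bundle: pairs of a \<open>d\<close>-plane and a line in it.\<close>

definition projectivization :: "nat \<Rightarrow> ((real^'m^'m) \<times> (real^'m^'m)) set" where
  "projectivization d = {(P, L). P \<in> grassmannian d \<and> L \<in> grassmannian 1 \<and>
     range ((*v) L) \<subseteq> range ((*v) P)}"

text \<open>Stiefel-Whitney classes by the projective bundle formula (Grothendieck, Hirzebruch). Let \<open>x\<close> be
  the first Stiefel-Whitney class of the tautological line bundle on the projective bundle \<open>\<pi>\<close>, i.e.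
  the pullback of the hyperplane class. By the Leray-Hirsch theorem the powers of \<open>x\<close> of exponent
  \<open>0, \<dots>, d - 1\<close> form a basis of the cohomology of the projective bundle over that of the
  Grassmannian, so exactly one family of classes satisfies \<open>w\<^sub>0 = 1\<close>, \<open>w\<^sub>i = 0\<close> for \<open>i > d\<close> and
  \<open>x\<^sup>d + \<pi>\<^sup>*w\<^sub>1 x\<^sup>d\<^sup>-\<^sup>1 + \<dots> + \<pi>\<^sup>*w\<^sub>d = 0\<close>. (The product \<open>\<Otimes>\<close> below is a sum of classes, and \<open>\<one>\<close> the zero
  class, as the groups are written multiplicatively.)\<close>

definition stiefel_whitney :: "nat \<Rightarrow> nat \<Rightarrow> (real^'m^'m) cochain set" where
  "stiefel_whitney d =
     (let G = top_of_set (grassmannian d);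
          B = top_of_set (projectivization d);
          x = cohomology_pullback 1 B snd hyperplane_class;
          H = cohomology_group d B
      in THE w. (\<forall>i. w i \<in> carrier (cohomology_group i G)) \<and>
                w 0 = cohomology_unit G \<and>
                (\<forall>i>d. w i = \<one>\<^bsub>cohomology_group i G\<^esub>) \<and>
                (\<Otimes>\<^bsub>H\<^esub>i\<in>{..d}.
                   cup i (d - i) B (cohomology_pullback i B fst (w i)) (cup_power B x (d - i)))
                = \<one>\<^bsub>H\<^esub>)"

text \<open>The class of the bundle on \<open>X\<close> classified by \<open>p\<close>.\<close>

definition bundle_stiefel_whitney ::
    "nat \<Rightarrow> nat \<Rightarrow> 'a topology \<Rightarrow> ('a \<Rightarrow> real^'m^'m) \<Rightarrow> 'a cochain set" where
  "bundle_stiefel_whitney d i X p = cohomology_pullback i X p (stiefel_whitney d i)"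


section \<open>The Cech bundle filtration\<close>

text \<open>For \<open>\<gamma> > 0\<close> the norm below induces the product topology, so \<open>E\<close> keeps its library topology.\<close>

type_synonym ('n, 'm) ambient = "(real^'n) \<times> (real^'m^'m)"

definition norm_gamma :: "real \<Rightarrow> ('n::finite, 'm::finite) ambient \<Rightarrow> real" where
  "norm_gamma \<gamma> = (\<lambda>(x, A). sqrt ((norm x)\<^sup>2 + \<gamma>\<^sup>2 * (norm A)\<^sup>2))"

text \<open>Only meaningful for non-empty \<open>S\<close>.\<close>

definition infdist_gamma ::
    "real \<Rightarrow> ('n::finite, 'm::finite) ambient \<Rightarrow> ('n, 'm) ambient set \<Rightarrow> real" where
  "infdist_gamma \<gamma> e S = (INF x\<in>S. norm_gamma \<gamma> (e - x))"

definition reach :: "real \<Rightarrow> ('n::finite, 'm::finite) ambient set \<Rightarrow> ereal" where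
  "reach \<gamma> S = Sup {ereal r | r. 0 \<le> r \<and> (\<forall>e. infdist_gamma \<gamma> e S < r \<longrightarrow>
     (\<exists>!x. x \<in> S \<and> (\<forall>y\<in>S. norm_gamma \<gamma> (e - x) \<le> norm_gamma \<gamma> (e - y))))}"

definition thickening ::
    "real \<Rightarrow> ('n::finite, 'm::finite) ambient set \<Rightarrow> real \<Rightarrow> ('n, 'm) ambient set" where
  "thickening \<gamma> S t = {e. infdist_gamma \<gamma> e S \<le> t}"

text \<open>For \<open>1 \<le> d < m\<close> the medial axis of the Grassmannian is non-empty (it contains the zero matrix),
  so the library's convention for the distance to the empty set plays no role.\<close>

definition t_max :: "real \<Rightarrow> nat \<Rightarrow> ('n::finite, 'm::finite) ambient set \<Rightarrow> real" where
  "t_max \<gamma> d S = \<gamma> * (INF e\<in>S. infdist (snd e) (medial_axis (grassmannian d)))"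

text \<open>The maps of the filtration. Where the nearest point is not unique, that is, on the medial axis,
  \<open>closest_point\<close> is an arbitrary choice; thickenings of parameter \<open>t < t_max\<close> avoid it.\<close>

definition filtration_map :: "nat \<Rightarrow> ('n::finite, 'm::finite) ambient \<Rightarrow> real^'m^'m" where
  "filtration_map d = (\<lambda>(x, A). closest_point (grassmannian d) A)"

definition persistent_stiefel_whitney ::
    "real \<Rightarrow> nat \<Rightarrow> nat \<Rightarrow> ('n::finite, 'm::finite) ambient set \<Rightarrow> real \<Rightarrow>
     ('n, 'm) ambient cochain set" where
  "persistent_stiefel_whitney \<gamma> d i S t =
     cohomology_pullback i (top_of_set (thickening \<gamma> S t)) (filtration_map d)
       (stiefel_whitney d i)"

definition lift :: "('a \<Rightarrow> real^'n) \<Rightarrow> ('a \<Rightarrow> real^'m^'m) \<Rightarrow> 'a \<Rightarrow> ('n::finite, 'm::finite) ambient"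
  where "lift u p x = (u x, p x)"

end

theory Submission
  imports Defs
begin

text \<open>A matrix at distance less than \<open>sqrt 2 / 2\<close> from a projection \<open>P\<close> of rank \<open>d\<close> has a quadratic form
  whose values on unit vectors of the image of \<open>P\<close> exceed those on its kernel, and this gap makes
  the nearest projection of rank \<open>d\<close> unique; exchanging a unit vector of the image for one of the kernel
  gives a second projection whose midpoint with \<open>P\<close> lies on the medial axis at exactly that distance.

  Below the reach, the nearest-point map onto the compact lift is a continuous retraction of the
  thickening, homotopic to the identity along segments, so the lifting map is a homotopy equivalence.
  On the lift itself the filtration map returns the given projection, so the statement on
  characteristic classes is the functoriality of pullbacks, whatever class is pulled back.\<close>

text \<open>That homotopic maps send a cycle to homologous cycles does not dualize to cochains: an
  actual chain homotopy, natural in the simplex, is required. It is chosen on universal simplices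
  instead of being written down by a triangulation of the prism. Evaluating cochains modulo two on
  integral chains makes the identities of the integral chain complex available for this.

  All projections of rank \<open>d\<close> have the same Frobenius norm, so a nearest one to
  \<open>A\<close> maximizes the linear functional sending \<open>R\<close> to
  \<open>A \<bullet> R\<close>, which is the sum of the quadratic form of \<open>A\<close> over an
  orthonormal basis of the plane. \<open>A\<close> may fail to be symmetric, so eigenspaces of
  \<open>A\<close> are avoided: the argument uses only this form, exchanges of a single basis
  vector, and dimension counts. The constant sqrt 2 / 2 is the reciprocal of sqrt 2, the norm of the
  difference of the projections onto two orthogonal lines: moving from \<open>P\<close> to
  \<open>A\<close> changes the gap, which is 1 at \<open>P\<close>, by at most sqrt 2 times the
  distance.\<close>

section \<open>Singular cohomology modulo two\<close>

text \<open>These simplification rules of the library hide the ring structure of \<open>bit\<close>.\<close>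

declare add_bit_eq_xor [simp del] mult_bit_eq_and [simp del]

text \<open>Integral coefficients are reduced modulo two on the fly. Facts about integral chains,
  such as the vanishing of the double boundary, thus pass to cochains without repeating any
  combinatorics of faces.\<close>

definition cochain_eval :: "'a cochain \<Rightarrow> 'a chain \<Rightarrow> bit" where
  "cochain_eval c a = (\<Sum>f\<in>Poly_Mapping.keys a. of_int (poly_mapping.lookup a f) * c f)"

lemma cochain_eval_superset:
  assumes "finite S" "Poly_Mapping.keys a \<subseteq> S"
  shows "cochain_eval c a = (\<Sum>f\<in>S. of_int (poly_mapping.lookup a f) * c f)"
  unfolding cochain_eval_def
  by (rule sum.mono_neutral_left) (use assms in \<open>auto simp: in_keys_iff\<close>)

lemma cochain_eval_0 [simp]: "cochain_eval c 0 = 0"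
  by (simp add: cochain_eval_def)

lemma cochain_eval_of [simp]: "cochain_eval c (frag_of f) = c f"
  by (simp add: cochain_eval_def keys_frag_of)

lemma cochain_eval_add: "cochain_eval c (a + b) = cochain_eval c a + cochain_eval c b"
proof -
  let ?S = "Poly_Mapping.keys a \<union> Poly_Mapping.keys b"
  have "cochain_eval c (a + b) = (\<Sum>f\<in>?S. of_int (poly_mapping.lookup (a + b) f) * c f)"
    by (rule cochain_eval_superset) (auto simp: keys_add)
  then show ?thesis
    by (simp add: cochain_eval_superset [of ?S] lookup_add distrib_right sum.distrib)
qed

lemma cochain_eval_cmul: "cochain_eval c (frag_cmul k a) = of_int k * cochain_eval c a"
proof -
  have "cochain_eval c (frag_cmul k a)
      = (\<Sum>f\<in>Poly_Mapping.keys a. of_int (poly_mapping.lookup (frag_cmul k a) f) * c f)"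
    by (rule cochain_eval_superset) (auto simp: keys_cmul)
  then show ?thesis
    by (simp add: cochain_eval_def sum_distrib_left mult.assoc)
qed

lemma cochain_eval_diff: "cochain_eval c (a - b) = cochain_eval c a - cochain_eval c b"
  using cochain_eval_add [of c "a - b" b] by (simp only: diff_add_cancel add_diff_cancel_right')

lemma cochain_eval_sum: "cochain_eval c (sum a I) = (\<Sum>i\<in>I. cochain_eval c (a i))"
  by (induction I rule: infinite_finite_induct) (simp_all add: cochain_eval_add)

lemma bit_add_self: "x + x = (0::bit)"
  by (metis mult_2 bit_2_eq_0 mult_zero_left)

text \<open>The signs of the integral boundary all reduce to 1, which reconciles it with the
  unsigned sum in \<open>coboundary\<close>.\<close>

lemma cochain_eval_boundary_of:
  "cochain_eval c (chain_boundary (Suc p) (frag_of f)) = (\<Sum>k\<le>Suc p. c (singular_face (Suc p) k f))"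
proof -
  have "of_int ((-1) ^ k) = (1::bit)" for k
    by (induction k) auto
  then show ?thesis
    by (simp add: chain_boundary_of cochain_eval_add cochain_eval_sum cochain_eval_cmul)
qed

lemma coboundary_simplex:
  "singular_simplex (Suc p) X f \<Longrightarrow>
    coboundary p X c f = cochain_eval c (chain_boundary (Suc p) (frag_of f))"
  by (simp add: coboundary_def cochain_eval_boundary_of del: sum.atMost_Suc)

lemma cochain_eval_coboundary:
  assumes "singular_chain (Suc p) X a"
  shows "cochain_eval (coboundary p X c) a = cochain_eval c (chain_boundary (Suc p) a)"
  using assms unfolding singular_chain_def
  by (induction a rule: frag_induction)
     (simp_all add: coboundary_simplex cochain_eval_diff chain_boundary_diff)

lemma cochain_eval_pullback:
  assumes "singular_chain p X a"
  shows "cochain_eval (cochain_pullback p X g c) a = cochain_eval c (chain_map p g a)"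
  using assms unfolding singular_chain_def
  by (induction a rule: frag_induction)
     (simp_all add: cochain_pullback_def cochain_eval_diff chain_map_diff)

section \<open>Cochains, coboundaries and their pullbacks\<close>

lemma cochain_eqI:
  assumes "a \<in> cochains p X" "b \<in> cochains p X" "\<And>f. singular_simplex p X f \<Longrightarrow> a f = b f"
  shows "a = b"
  using assms by (force simp: cochains_def)

lemma zero_in_cochains [simp]: "(\<lambda>_. 0) \<in> cochains p X"
  by (simp add: cochains_def)

lemma add_in_cochains: "a \<in> cochains p X \<Longrightarrow> b \<in> cochains p X \<Longrightarrow> (\<lambda>f. a f + b f) \<in> cochains p X"
  by (simp add: cochains_def)

lemma coboundary_in_cochains [simp]: "coboundary p X c \<in> cochains (Suc p) X"
  by (simp add: cochains_def coboundary_def)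

lemma pullback_in_cochains [simp]: "cochain_pullback p X g c \<in> cochains p X"
  by (simp add: cochains_def cochain_pullback_def)

lemma coboundary_add: "coboundary p X (\<lambda>f. a f + b f) = (\<lambda>f. coboundary p X a f + coboundary p X b f)"
  by (rule ext) (simp add: coboundary_def sum.distrib)

lemma coboundary_zero [simp]: "coboundary p X (\<lambda>_. 0) = (\<lambda>_. 0)"
  by (rule ext) (simp add: coboundary_def)

lemma coboundary_coboundary: "coboundary (Suc p) X (coboundary p X c) = (\<lambda>_. 0)"
proof (rule cochain_eqI)
  fix f assume f: "singular_simplex (Suc (Suc p)) X f"
  then have "singular_chain (Suc p) X (chain_boundary (Suc (Suc p)) (frag_of f))"
    by (simp add: singular_chain_boundary_alt singular_chain_of)
  with f show "coboundary (Suc p) X (coboundary p X c) f = 0"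
    by (simp add: coboundary_simplex cochain_eval_coboundary chain_boundary_boundary_alt
        singular_chain_of)
qed simp_all

lemma coboundary_pullback:
  assumes "continuous_map X Y g"
  shows "coboundary p X (cochain_pullback p X g c) = cochain_pullback (Suc p) X g (coboundary p Y c)"
proof (rule cochain_eqI)
  fix f assume f: "singular_simplex (Suc p) X f"
  then have "singular_chain p X (chain_boundary (Suc p) (frag_of f))"
    by (simp add: singular_chain_boundary_alt singular_chain_of)
  moreover have "singular_simplex (Suc p) Y (simplex_map (Suc p) g f)"
    using f assms by (rule singular_simplex_simplex_map)
  moreover have "chain_map p g (chain_boundary (Suc p) (frag_of f))
      = chain_boundary (Suc p) (frag_of (simplex_map (Suc p) g f))"
    using chain_boundary_chain_map [of "Suc p" X "frag_of f" g] f by (simp add: singular_chain_of)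
  ultimately show "coboundary p X (cochain_pullback p X g c) f
      = cochain_pullback (Suc p) X g (coboundary p Y c) f"
    using f by (simp add: coboundary_simplex cochain_eval_pullback cochain_pullback_def [of "Suc p"])
qed simp_all

lemma pullback_add:
  "cochain_pullback p X g (\<lambda>f. a f + b f) = (\<lambda>f. cochain_pullback p X g a f + cochain_pullback p X g b f)"
  by (rule ext) (simp add: cochain_pullback_def)

lemma pullback_zero [simp]: "cochain_pullback p X g (\<lambda>_. 0) = (\<lambda>_. 0)"
  by (rule ext) (simp add: cochain_pullback_def)

lemma zero_in_coboundaries [simp]: "(\<lambda>_. 0) \<in> coboundaries p X"
  by (cases p) (auto simp: coboundaries_def intro: image_eqI [of _ _ "\<lambda>_. 0"])

lemma coboundaries_Suc: "coboundaries (Suc p) X = coboundary p X ` cochains p X"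
  by (simp add: coboundaries_def)

lemma coboundaries_0: "coboundaries 0 X = {\<lambda>_. 0}"
  by (simp add: coboundaries_def)

lemma add_in_coboundaries:
  "a \<in> coboundaries p X \<Longrightarrow> b \<in> coboundaries p X \<Longrightarrow> (\<lambda>f. a f + b f) \<in> coboundaries p X"
proof (cases p)
  case (Suc q)
  assume "a \<in> coboundaries p X" "b \<in> coboundaries p X"
  then obtain a' b' where "a' \<in> cochains q X" "b' \<in> cochains q X"
    "a = coboundary q X a'" "b = coboundary q X b'"
    by (auto simp: Suc coboundaries_Suc)
  then show ?thesis
    by (auto simp: Suc coboundaries_Suc coboundary_add add_in_cochains
        intro!: image_eqI [of _ _ "\<lambda>f. a' f + b' f"])
qed (simp add: coboundaries_0)

lemma pullback_in_coboundaries: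
  assumes "continuous_map X Y g" "b \<in> coboundaries p Y"
  shows "cochain_pullback p X g b \<in> coboundaries p X"
  using assms by (cases p) (auto simp: coboundaries_0 coboundaries_Suc simp flip: coboundary_pullback)

lemma coboundaries_subset: "coboundaries p X \<subseteq> carrier (cocycle_group p X)"
  by (cases p) (auto simp: coboundaries_0 coboundaries_Suc cocycle_group_def coboundary_coboundary)

section \<open>Cohomology groups and induced maps\<close>

lemma comm_group_cocycle_group: "comm_group (cocycle_group p X)"
proof (rule comm_groupI)
  fix x assume "x \<in> carrier (cocycle_group p X)"
  then show "\<exists>y\<in>carrier (cocycle_group p X). y \<otimes>\<^bsub>cocycle_group p X\<^esub> x = \<one>\<^bsub>cocycle_group p X\<^esub>"
    by (intro bexI [of _ x]) (simp_all add: cocycle_group_def bit_add_self)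
qed (auto simp: cocycle_group_def coboundary_add add_in_cochains add.assoc add.commute)

lemma normal_coboundaries: "coboundaries p X \<lhd> cocycle_group p X"
proof -
  interpret comm_group "cocycle_group p X"
    by (rule comm_group_cocycle_group)
  have "subgroup (coboundaries p X) (cocycle_group p X)"
  proof (rule subgroupI)
    fix a assume a: "a \<in> coboundaries p X"
    have "a \<otimes>\<^bsub>cocycle_group p X\<^esub> a = \<one>\<^bsub>cocycle_group p X\<^esub>"
      by (simp add: cocycle_group_def bit_add_self)
    then have "inv\<^bsub>cocycle_group p X\<^esub> a = a"
      using a coboundaries_subset by (intro inv_equality) blast+
    with a show "inv\<^bsub>cocycle_group p X\<^esub> a \<in> coboundaries p X" by simp
  next
    fix a b assume "a \<in> coboundaries p X" "b \<in> coboundaries p X"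
    then show "a \<otimes>\<^bsub>cocycle_group p X\<^esub> b \<in> coboundaries p X"
      by (simp add: cocycle_group_def add_in_coboundaries)
  qed (use coboundaries_subset zero_in_coboundaries in blast)+
  then show ?thesis
    by (rule normal_iff_subgroup [THEN iffD2])
qed

lemma carrier_cohomology_group:
  "carrier (cohomology_group p X) = cohomology_class p X ` carrier (cocycle_group p X)"
  by (auto simp: cohomology_group_def FactGroup_def RCOSETS_def cohomology_class_def)

lemma mult_cohomology_group:
  assumes "a \<in> carrier (cocycle_group p X)" "b \<in> carrier (cocycle_group p X)"
  shows "cohomology_class p X a \<otimes>\<^bsub>cohomology_group p X\<^esub> cohomology_class p X b
    = cohomology_class p X (\<lambda>f. a f + b f)"
  using normal.rcos_sum [OF normal_coboundaries assms]
  by (simp add: cohomology_group_def cohomology_class_def cocycle_group_def)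

lemma in_cohomology_class:
  "c' \<in> cohomology_class p X c \<longleftrightarrow> (\<exists>b\<in>coboundaries p X. c' = (\<lambda>f. b f + c f))"
  by (auto simp: cohomology_class_def r_coset_def cocycle_group_def)

lemma cohomology_class_self [simp]: "c \<in> cohomology_class p X c"
  unfolding in_cohomology_class by (rule bexI [of _ "\<lambda>_. 0"]) auto

lemma cohomology_class_add:
  assumes "b \<in> coboundaries p X"
  shows "cohomology_class p X (\<lambda>f. b f + c f) = cohomology_class p X c"
proof -
  have sub: "cohomology_class p X (\<lambda>f. b f + c f) \<subseteq> cohomology_class p X c" 
    if "b \<in> coboundaries p X" for b c
  proof
    fix c' assume "c' \<in> cohomology_class p X (\<lambda>f. b f + c f)"
    then obtain b' where "b' \<in> coboundaries p X" "c' = (\<lambda>f. b' f + (b f + c f))"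
      by (auto simp: in_cohomology_class)
    with that show "c' \<in> cohomology_class p X c"
      unfolding in_cohomology_class
      by (intro bexI [of _ "\<lambda>f. b' f + b f"]) (auto simp: add.assoc add_in_coboundaries)
  qed
  \<comment> \<open>In characteristic two, adding \<open>b\<close> twice returns to
    \<open>c\<close>, so the single inclusion \<open>sub\<close> yields both directions.\<close>
  have "c = (\<lambda>f. b f + (b f + c f))"
    by (rule ext) (simp add: bit_add_self flip: add.assoc)
  with sub [OF assms, of c] sub [OF assms, of "\<lambda>f. b f + c f"] show ?thesis
    by force
qed

text \<open>Representatives differ by coboundaries, which pull back to coboundaries; the union
  defining \<open>cohomology_pullback\<close> is therefore a union of copies of one class.\<close>

lemma cohomology_pullback_class:
  assumes "continuous_map X Y g"
  shows "cohomology_pullback p X g (cohomology_class p Y c)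
    = cohomology_class p X (cochain_pullback p X g c)"
proof -
  have "cohomology_class p X (cochain_pullback p X g c') = cohomology_class p X (cochain_pullback p X g c)"
    if "c' \<in> cohomology_class p Y c" for c'
  proof -
    from that obtain b where "b \<in> coboundaries p Y" "c' = (\<lambda>f. b f + c f)"
      by (auto simp: in_cohomology_class)
    with assms show ?thesis
      by (simp add: pullback_add cohomology_class_add pullback_in_coboundaries)
  qed
  then show ?thesis
    unfolding cohomology_pullback_def using cohomology_class_self by blast
qed

lemma cohomology_pullback_Union:
  "cohomology_pullback p X g (\<Union>i\<in>I. w i) = (\<Union>i\<in>I. cohomology_pullback p X g (w i))"
  by (auto simp: cohomology_pullback_def)

lemma cochain_pullback_compose:
  assumes "continuous_map X Y f"
  shows "cochain_pullback p X f (cochain_pullback p Y g c) = cochain_pullback p X (g \<circ> f) c"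
  by (rule ext)
     (simp add: cochain_pullback_def simplex_map_compose singular_simplex_simplex_map [OF _ assms])

text \<open>Both sides are unions over the elements of \<open>w\<close>, so any set of cochains is
  admissible. In the final proof it is \<open>stiefel_whitney d i\<close>, a value given by
  \<open>THE\<close>, which can thus be treated as a black box.\<close>

lemma cohomology_pullback_compose:
  assumes "continuous_map X Y f"
  shows "cohomology_pullback p X f (cohomology_pullback p Y g w) = cohomology_pullback p X (g \<circ> f) w"
  by (simp add: cohomology_pullback_def [of p Y] cohomology_pullback_Union
      cohomology_pullback_class [OF assms] cochain_pullback_compose [OF assms])
     (simp add: cohomology_pullback_def)

lemma cochain_pullback_cong:
  assumes "\<And>x. x \<in> topspace X \<Longrightarrow> f x = g x"
  shows "cochain_pullback p X f c = cochain_pullback p X g c"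
  by (rule ext) (metis assms cochain_pullback_def simplex_map_eq)

lemma cohomology_pullback_cong:
  assumes "\<And>x. x \<in> topspace X \<Longrightarrow> f x = g x"
  shows "cohomology_pullback p X f w = cohomology_pullback p X g w"
  by (simp add: cohomology_pullback_def cochain_pullback_cong [OF assms])

lemma cochain_pullback_id: "c \<in> cochains p X \<Longrightarrow> cochain_pullback p X id c = c"
  by (rule cochain_eqI [OF pullback_in_cochains])
     (auto simp: cochain_pullback_def singular_simplex_def extensional_restrict)

lemma cohomology_pullback_id:
  assumes "w \<in> carrier (cohomology_group p X)"
  shows "cohomology_pullback p X id w = w"
  using assms
  by (auto simp: carrier_cohomology_group cohomology_pullback_class cochain_pullback_id cocycle_group_def)

lemma cochain_pullback_cocycle:
  assumes "continuous_map X Y g" "c \<in> carrier (cocycle_group p Y)"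
  shows "cochain_pullback p X g c \<in> carrier (cocycle_group p X)"
  using assms by (simp add: cocycle_group_def coboundary_pullback)

lemma cohomology_pullback_hom:
  assumes "continuous_map X Y g"
  shows "cohomology_pullback p X g \<in> hom (cohomology_group p Y) (cohomology_group p X)"
proof (rule homI)
  fix v assume "v \<in> carrier (cohomology_group p Y)"
  then show "cohomology_pullback p X g v \<in> carrier (cohomology_group p X)"
    using assms cochain_pullback_cocycle
    by (fastforce simp: carrier_cohomology_group cohomology_pullback_class)
next
  fix v w assume "v \<in> carrier (cohomology_group p Y)" "w \<in> carrier (cohomology_group p Y)"
  then obtain a b where ab: "a \<in> carrier (cocycle_group p Y)" "b \<in> carrier (cocycle_group p Y)"
    and vw: "v = cohomology_class p Y a" "w = cohomology_class p Y b"
    by (auto simp: carrier_cohomology_group)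
  show "cohomology_pullback p X g (v \<otimes>\<^bsub>cohomology_group p Y\<^esub> w) =
    cohomology_pullback p X g v \<otimes>\<^bsub>cohomology_group p X\<^esub> cohomology_pullback p X g w"
    by (simp add: vw ab mult_cohomology_group cohomology_pullback_class [OF assms] pullback_add
        cochain_pullback_cocycle [OF assms])
qed

lemma cohomology_pullback_unit:
  assumes "continuous_map X Y g"
  shows "cohomology_pullback 0 X g (cohomology_unit Y) = cohomology_unit X"
proof -
  have "cochain_pullback 0 X g (\<lambda>f. if singular_simplex 0 Y f then 1 else 0)
      = (\<lambda>f. if singular_simplex 0 X f then 1 else 0)"
    by (rule ext) (use assms in \<open>simp add: cochain_pullback_def singular_simplex_simplex_map\<close>)
  then show ?thesis
    by (simp add: cohomology_unit_def cohomology_pullback_class [OF assms])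
qed

section \<open>Cup products under pullback\<close>

lemma singular_simplex_front_face:
  assumes "singular_simplex (p + q) X f"
  shows "singular_simplex p X (restrict f (standard_simplex p))"
proof -
  have "continuous_map (subtopology (powertop_real UNIV) (standard_simplex p)) X f"
    using assms standard_simplex_mono [of p "p + q"] continuous_map_from_subtopology_mono
    by (auto simp: singular_simplex_def)
  then show ?thesis
    by (simp add: singular_simplex_def)
qed

lemma shift_in_standard_simplex:
  assumes "x \<in> standard_simplex q"
  shows "(\<lambda>i. if i < p then 0 else x (i - p)) \<in> standard_simplex (p + q)"
proof -
  have "(\<Sum>i\<le>p+q. if i < p then 0 else x (i - p)) = (\<Sum>i\<in>{p..p+q}. x (i - p))"
    by (rule sum.mono_neutral_cong_right) auto
  also have "\<dots> = (\<Sum>i\<le>q. x i)"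
    by (rule sum.reindex_bij_witness [of _ "\<lambda>i. i + p" "\<lambda>i. i - p"]) auto
  finally show ?thesis
    using assms by (auto simp: standard_simplex_def)
qed

lemma singular_simplex_back_face:
  assumes "singular_simplex (p + q) X f"
  shows "singular_simplex q X (restrict (f \<circ> (\<lambda>x i. if i < p then 0 else x (i - p))) (standard_simplex q))"
proof -
  have "continuous_map (powertop_real UNIV) euclideanreal (\<lambda>x. if i < p then 0 else x (i - p))" for i
    by (auto intro: continuous_map_product_projection)
  then have "continuous_map (subtopology (powertop_real UNIV) (standard_simplex q))
      (subtopology (powertop_real UNIV) (standard_simplex (p + q)))
      (\<lambda>x i. if i < p then 0 else x (i - p))"
    by (auto simp: continuous_map_in_subtopology continuous_map_componentwise
        shift_in_standard_simplex continuous_map_from_subtopology)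
  with assms show ?thesis
    by (auto simp: singular_simplex_def intro: continuous_map_compose)
qed

lemma cochain_pullback_cup:
  assumes "continuous_map X Y g"
  shows "cochain_pullback (p + q) X g (cochain_cup p q Y a b)
    = cochain_cup p q X (cochain_pullback p X g a) (cochain_pullback q X g b)"
proof
  fix f
  let ?s = "\<lambda>(x::nat\<Rightarrow>real) i. if i < p then 0 else x (i - p)"
  show "cochain_pullback (p + q) X g (cochain_cup p q Y a b) f
    = cochain_cup p q X (cochain_pullback p X g a) (cochain_pullback q X g b) f"
  proof (cases "singular_simplex (p + q) X f")
    case True
    have "restrict (simplex_map (p + q) g f) (standard_simplex p)
        = simplex_map p g (restrict f (standard_simplex p))"
      using standard_simplex_mono [of p "p + q"] by (auto simp: simplex_map_def fun_eq_iff)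
    moreover have "restrict (simplex_map (p + q) g f \<circ> ?s) (standard_simplex q)
        = simplex_map q g (restrict (f \<circ> ?s) (standard_simplex q))"
      using shift_in_standard_simplex [of _ q p] by (auto simp: simplex_map_def fun_eq_iff)
    ultimately show ?thesis
      using True assms singular_simplex_front_face [OF True] singular_simplex_back_face [OF True]
      by (simp add: cochain_pullback_def cochain_cup_def singular_simplex_simplex_map)
  qed (simp add: cochain_pullback_def cochain_cup_def)
qed

lemma inj_on_simplex_map:
  assumes "inj_on g (topspace X)"
  shows "inj_on (simplex_map p g) (singular_simplex_set p X)"
proof (rule inj_onI)
  fix f f' assume f: "f \<in> singular_simplex_set p X" "f' \<in> singular_simplex_set p X"
    and eq: "simplex_map p g f = simplex_map p g f'"
  show "f = f'"
  proof (rule extensionalityI [of _ "standard_simplex p"])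
    fix x assume x: "x \<in> standard_simplex p"
    then have "g (f x) = g (f' x)"
      using fun_cong [OF eq, of x] by (simp add: simplex_map_def)
    moreover have "f x \<in> topspace X" "f' x \<in> topspace X"
      using f x by (auto simp: singular_simplex_def continuous_map_def)
    ultimately show "f x = f' x"
      using assms by (simp add: inj_on_eq_iff)
  qed (use f in \<open>auto simp: singular_simplex_def\<close>)
qed

text \<open>Along an injective map distinct simplices have distinct images, so \<open>c\<close> can
  be transported to the image simplices and extended by zero.\<close>

lemma cochain_pullback_surj:
  assumes "continuous_map X Y g" "inj_on g (topspace X)" "c \<in> cochains p X"
  obtains c' where "c' \<in> cochains p Y" "cochain_pullback p X g c' = c"
proof
  let ?h = "inv_into (singular_simplex_set p X) (simplex_map p g)"
  let ?c = "\<lambda>f. if f \<in> simplex_map p g ` singular_simplex_set p X then c (?h f) else 0"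
  show "?c \<in> cochains p Y"
    using assms(1) by (auto simp: cochains_def singular_simplex_simplex_map)
  show "cochain_pullback p X g ?c = c"
  proof (rule cochain_eqI [OF pullback_in_cochains assms(3)])
    fix f assume "singular_simplex p X f"
    then show "cochain_pullback p X g ?c f = c f"
      using inv_into_f_f [OF inj_on_simplex_map [OF assms(2)], of f p]
      by (auto simp: cochain_pullback_def)
  qed
qed

text \<open>Injectivity of \<open>g\<close> makes the pullback of cochains surjective, which spares the Leibniz rule for cup
  products.\<close>

lemma cohomology_pullback_cup:
  assumes g: "continuous_map X Y g" and inj: "inj_on g (topspace X)"
    and v: "v \<in> carrier (cohomology_group p Y)" and w: "w \<in> carrier (cohomology_group q Y)"
  shows "cohomology_pullback (p + q) X g (cup p q Y v w)
    = cup p q X (cohomology_pullback p X g v) (cohomology_pullback q X g w)"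
proof -
  \<comment> \<open>By surjectivity on cochains, the coboundaries of \<open>X\<close> are exactly
    the pullbacks of those of \<open>Y\<close>, so the induced map is the elementwise image of a
    class. Both sides of the goal then become unions over the same pairs of representatives.\<close>
  have lift: "cohomology_pullback r X g z = cochain_pullback r X g ` z"
    if z: "z \<in> carrier (cohomology_group r Y)" for r z
  proof -
    obtain c where c: "z = cohomology_class r Y c"
      using z by (auto simp: carrier_cohomology_group)
    have cobd: "coboundaries r X = cochain_pullback r X g ` coboundaries r Y"
    proof (cases r)
      case (Suc s)
      show ?thesis
      proof
        show "coboundaries r X \<subseteq> cochain_pullback r X g ` coboundaries r Y"
        proof
          fix b assume "b \<in> coboundaries r X"
          then obtain e where "e \<in> cochains s X" "b = coboundary s X e"
            by (auto simp: Suc coboundaries_Suc)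
          moreover then obtain e' where "e' \<in> cochains s Y" "cochain_pullback s X g e' = e"
            using cochain_pullback_surj [OF g inj] by metis
          ultimately show "b \<in> cochain_pullback r X g ` coboundaries r Y"
            by (auto simp: Suc coboundaries_Suc coboundary_pullback [OF g])
        qed
      qed (use pullback_in_coboundaries [OF g] in auto)
    qed (simp add: coboundaries_0)
    have "cohomology_pullback r X g z
        = (\<lambda>b f. b f + cochain_pullback r X g c f) ` coboundaries r X"
      unfolding c cohomology_pullback_class [OF g] using in_cohomology_class by blast
    also have "\<dots> = cochain_pullback r X g ` (\<lambda>b f. b f + c f) ` coboundaries r Y"
      unfolding cobd image_image by (simp add: pullback_add)
    also have "(\<lambda>b f. b f + c f) ` coboundaries r Y = z"
      unfolding c using in_cohomology_class by blast
    finally show ?thesis .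
  qed
  show ?thesis
    unfolding lift [OF v] lift [OF w]
    by (simp add: cup_def cohomology_pullback_Union cohomology_pullback_class [OF g]
        cochain_pullback_cup [OF g])
qed

section \<open>Homotopy invariance of cohomology\<close>

lemma contractible_standard_simplex:
  "contractible_space (subtopology (powertop_real UNIV) (standard_simplex p))"
proof -
  let ?D = "subtopology (powertop_real UNIV) (standard_simplex p)"
  let ?v = "\<lambda>j. if j = 0 then 1 else 0 :: real"
  have "homotopic_with (\<lambda>x. True) ?D ?D id (\<lambda>x. ?v)"
    unfolding homotopic_with_def
  proof (intro exI conjI allI ballI)
    let ?h = "\<lambda>(s, x) i. (1 - s) * x i + s * ?v i"
    have "continuous_map (prod_topology (top_of_set {0..1::real}) ?D) euclideanreal
        (\<lambda>z. (1 - fst z) * snd z i + fst z * ?v i)" for i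
    proof -
      have 1: "continuous_map (prod_topology (top_of_set {0..1::real}) ?D) euclideanreal fst"
        using continuous_map_fst continuous_map_in_subtopology by blast
      have 2: "continuous_map (prod_topology (top_of_set {0..1::real}) ?D) euclideanreal (\<lambda>z. snd z i)"
        by (rule continuous_map_compose [where g = "\<lambda>x. x i", unfolded o_def, OF continuous_map_snd])
           (intro continuous_map_from_subtopology continuous_map_product_projection UNIV_I)
      show ?thesis
        by (intro continuous_intros 1 2)
    qed
    then show "continuous_map (prod_topology (top_of_set {0..1}) ?D) ?D ?h"
      by (auto simp: continuous_map_in_subtopology continuous_map_componentwise case_prod_unfold
          convex_standard_simplex)
  qed auto
  then show ?thesis
    unfolding contractible_space_def by blast
qed

text \<open>The prism operator is built by acyclic models: its values on the universal simplices are chains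
  in the contractible space below.\<close>

definition cylinder :: "nat \<Rightarrow> (real \<times> (nat \<Rightarrow> real)) topology" where
  "cylinder p = prod_topology (top_of_set {0..1}) (subtopology (powertop_real UNIV) (standard_simplex p))"

lemma contractible_cylinder: "contractible_space (cylinder p)"
  by (simp add: cylinder_def contractible_space_prod_topology contractible_standard_simplex
      convex_imp_contractible)

definition universal_simplex :: "nat \<Rightarrow> (nat \<Rightarrow> real) \<Rightarrow> (nat \<Rightarrow> real)" where
  "universal_simplex p = restrict id (standard_simplex p)"

lemma singular_universal_simplex:
  "singular_simplex p (subtopology (powertop_real UNIV) (standard_simplex p)) (universal_simplex p)"
  by (simp add: singular_simplex_def universal_simplex_def)

text \<open>The contraction makes \<open>c\<close> homologous to its image under a constant map. In
  positive degree that image is a cycle of a one-point space, hence a boundary. In degree 0 a point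
  does not bound, which is why a difference of two points is demanded there: its image is
  zero.\<close>

lemma contractible_cycle_is_boundary:
  assumes X: "contractible_space X" and c: "singular_chain p X c" "chain_boundary p c = 0"
    and 0: "p = 0 \<Longrightarrow> \<exists>f g. singular_simplex p X f \<and> singular_simplex p X g \<and> c = frag_of f - frag_of g"
  shows "\<exists>d. singular_chain (Suc p) X d \<and> chain_boundary (Suc p) d = c"
proof -
  obtain a where "homotopic_with (\<lambda>x. True) X X id (\<lambda>x. a)"
    using X by (auto simp: contractible_space_def)
  \<comment> \<open>The relative theorem is applied with an empty subspace, for which the condition
    on the homotopy holds trivially.\<close>
  then have hom: "homotopic_with (\<lambda>h. h \<in> {} \<rightarrow> {}) X X id (\<lambda>x. a)"
    by (simp add: Pi_def)
  have cyc: "singular_relcycle p X {} c"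
    using c by (simp add: singular_cycle)
  have 1: "homologous_rel p X {} c (chain_map p (\<lambda>x. a) c)"
    using homotopic_imp_homologous_rel_chain_maps [OF hom cyc] c by (simp add: chain_map_ident)
  have cont: "continuous_map X X (\<lambda>x. a)"
    using hom homotopic_with_imp_continuous_maps by blast
  have 2: "singular_relboundary p X {} (chain_map p (\<lambda>x. a) c)"
  proof (cases p)
    case 0
    with assms(4) obtain f g where fg: "c = frag_of f - frag_of g" by blast
    have "simplex_map p (\<lambda>x. a) f = simplex_map p (\<lambda>x. a) g"
      by (simp add: simplex_map_def o_def)
    then show ?thesis
      by (simp add: fg chain_map_diff)
  next
    case (Suc q)
    show ?thesis
    \<comment> \<open>Over an empty space \<open>a\<close> need not be a point of \<open>X\<close>,
      but then 0 is the only chain.\<close>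
    proof (cases "topspace X = {}")
      case True
      then show ?thesis
        using c by (simp add: singular_chain_empty)
    next
      case False
      then have a: "topspace (subtopology X {a}) = {a}"
        using cont by (auto simp: continuous_map_def)
      have "continuous_map X (subtopology X {a}) (\<lambda>x. a)"
        using cont by (simp add: continuous_map_in_subtopology)
      then have "singular_relcycle p (subtopology X {a}) {} (chain_map p (\<lambda>x. a) c)"
        using singular_relcycle_chain_map [OF cyc] by blast
      then have "singular_relboundary p (subtopology X {a}) {} (chain_map p (\<lambda>x. a) c)"
        using singular_boundary_eq_cycle_singleton [OF a] Suc by simp
      then show ?thesis
        by (auto simp: singular_boundary singular_chain_subtopology)
    qed
  qed
  have "singular_relboundary p X {} c"
    using singular_relboundary_add [OF 1 [unfolded homologous_rel_def] 2] by simp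
  then show ?thesis
    by (simp add: singular_boundary)
qed



text \<open>The chain \<open>e\<close> prescribes the prism over the universal simplex and
  naturality dictates all other values. It is a parameter because the universal chain of one
  dimension is chosen in terms of the operator one dimension below.\<close>

definition prism :: "nat \<Rightarrow> (real \<times> (nat \<Rightarrow> real)) chain \<Rightarrow> 'a chain \<Rightarrow> (real \<times> 'a) chain" where
  "prism p e = frag_extend (\<lambda>f. chain_map (Suc p) (map_prod id f) e)"

lemma prism_0 [simp]: "prism p e 0 = 0"
  by (simp add: prism_def)

lemma prism_of [simp]: "prism p e (frag_of f) = chain_map (Suc p) (map_prod id f) e"
  by (simp add: prism_def)

lemma prism_diff: "prism p e (a - b) = prism p e a - prism p e b"
  by (simp add: prism_def frag_extend_diff)

lemma continuous_map_cylinder: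
  assumes "singular_simplex p X f"
  shows "continuous_map (cylinder p) (prod_topology (top_of_set {0..1}) X) (map_prod id f)"
  unfolding cylinder_def map_prod_def
  using assms
  by (intro continuous_map_prod_top [THEN iffD2] disjI2) (auto simp: singular_simplex_def id_def)

lemma singular_chain_prism:
  assumes "singular_chain (Suc p) (cylinder p) e" "singular_chain p X c"
  shows "singular_chain (Suc p) (prod_topology (top_of_set {0..1}) X) (prism p e c)"
  unfolding prism_def
  by (rule singular_chain_extend)
     (use assms in \<open>auto simp: singular_chain_def [of p X] intro!: singular_chain_chain_map continuous_map_cylinder\<close>)

lemma prism_chain_map:
  assumes e: "singular_chain (Suc p) (cylinder p) e" and "singular_chain p X c"
  shows "prism p e (chain_map p g c) = chain_map (Suc p) (map_prod id g) (prism p e c)"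
  using assms(2) unfolding singular_chain_def
proof (induction c rule: frag_induction)
  case (one f)
  \<comment> \<open>The two maps agree only over the standard simplex, outside which
    \<open>simplex_map\<close> is undefined; \<open>e\<close> is supported in the cylinder.\<close>
  have "chain_map (Suc p) (map_prod id (simplex_map p g f)) e
      = chain_map (Suc p) (map_prod id g \<circ> map_prod id f) e"
    by (rule chain_map_eq [OF e]) (auto simp: cylinder_def simplex_map_def)
  then show ?case
    by (simp only: chain_map_of prism_of chain_map_compose o_apply)
qed (auto simp: prism_diff chain_map_diff)

text \<open>The prescribed boundary is top minus bottom minus the prism over the faces, the defining
  equation of a chain homotopy. That such a chain exists is settled in the lemma
  \<open>universal_prism\<close>, since the right-hand side is a cycle of the contractible
  cylinder.\<close>

primrec universal_prism :: "nat \<Rightarrow> (real \<times> (nat \<Rightarrow> real)) chain" where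
  "universal_prism 0 = (SOME e. singular_chain 1 (cylinder 0) e \<and>
     chain_boundary 1 e = frag_of (simplex_map 0 (Pair 1) (universal_simplex 0)) -
       frag_of (simplex_map 0 (Pair 0) (universal_simplex 0)))"
| "universal_prism (Suc p) = (SOME e. singular_chain (Suc (Suc p)) (cylinder (Suc p)) e \<and>
     chain_boundary (Suc (Suc p)) e = frag_of (simplex_map (Suc p) (Pair 1) (universal_simplex (Suc p))) -
       frag_of (simplex_map (Suc p) (Pair 0) (universal_simplex (Suc p))) -
       prism p (universal_prism p) (chain_boundary (Suc p) (frag_of (universal_simplex (Suc p)))))"

lemma continuous_map_slice:
  "s \<in> {0..1} \<Longrightarrow> continuous_map X (prod_topology (top_of_set {0..1::real}) X) (Pair s)"
  by (simp add: continuous_map_pairwise o_def)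

text \<open>Naturality carries the formula from the universal simplex to every simplex. The chains
  \<open>e\<close> and \<open>e'\<close> are kept abstract so that the result can serve inside the
  induction that constructs them. In degree 0 the boundary is 0, so the truncated
  \<open>p - 1\<close> is harmless.\<close>

lemma chain_boundary_prism_aux:
  assumes e: "singular_chain (Suc p) (cylinder p) e"
    and e': "p > 0 \<Longrightarrow> singular_chain p (cylinder (p - 1)) e'"
    and bd: "chain_boundary (Suc p) e = frag_of (simplex_map p (Pair 1) (universal_simplex p)) -
       frag_of (simplex_map p (Pair 0) (universal_simplex p)) -
       prism (p - 1) e' (chain_boundary p (frag_of (universal_simplex p)))"
    and c: "singular_chain p X c"
  shows "chain_boundary (Suc p) (prism p e c)
    = chain_map p (Pair 1) c - chain_map p (Pair 0) c - prism (p - 1) e' (chain_boundary p c)"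
  using c unfolding singular_chain_def
proof (induction c rule: frag_induction)
  case (one f)
  then have f: "singular_simplex p X f" by simp
  let ?u = "frag_of (universal_simplex p)"
  have ends: "chain_map p (map_prod id f) (frag_of (simplex_map p (Pair s) (universal_simplex p)))
      = frag_of (simplex_map p (Pair s) f)" for s
    by (auto simp: simplex_map_def universal_simplex_def fun_eq_iff intro!: arg_cong [of _ _ frag_of])
  have faces: "chain_map p (map_prod id f) (prism (p - 1) e' (chain_boundary p ?u))
      = prism (p - 1) e' (chain_boundary p (frag_of f))"
  proof (cases p)
    case (Suc q)
    let ?D = "subtopology (powertop_real UNIV) (standard_simplex p)"
    have u: "singular_chain p ?D ?u"
      by (simp add: singular_chain_of singular_universal_simplex)
    then have "singular_chain (p - 1) ?D (chain_boundary p ?u)"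
      using singular_chain_boundary [OF u] by simp
    then have "chain_map p (map_prod id f) (prism (p - 1) e' (chain_boundary p ?u))
        = prism (p - 1) e' (chain_map (p - 1) f (chain_boundary p ?u))"
      using prism_chain_map [of "p - 1" e' ?D "chain_boundary p ?u" f] e' Suc by simp
    also have "chain_map (p - 1) f (chain_boundary p ?u) = chain_boundary p (chain_map p f ?u)"
      unfolding One_nat_def by (rule chain_boundary_chain_map [OF u, symmetric])
    also have "chain_map p f ?u = frag_of f"
      unfolding universal_simplex_def by (rule singular_simplex_chain_map_id [OF f])
    finally show ?thesis .
  qed (simp add: chain_boundary_def)
  have "chain_boundary (Suc p) (prism p e (frag_of f))
      = chain_map p (map_prod id f) (chain_boundary (Suc p) e)"
    using chain_boundary_chain_map [OF e] by simp
  then show ?case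
    unfolding bd chain_map_diff ends faces by simp
qed (simp_all add: chain_boundary_diff chain_map_diff prism_diff)

text \<open>Two earlier degrees enter: the cycle to be filled in degree \<open>Suc r\<close>
  involves the prism in degree \<open>r\<close>, whose boundary formula involves the one in degree
  \<open>r - 1\<close>. Hence the strong induction.\<close>

lemma universal_prism:
  "singular_chain (Suc p) (cylinder p) (universal_prism p) \<and>
   chain_boundary (Suc p) (universal_prism p) =
     frag_of (simplex_map p (Pair 1) (universal_simplex p)) -
     frag_of (simplex_map p (Pair 0) (universal_simplex p)) -
     prism (p - 1) (universal_prism (p - 1)) (chain_boundary p (frag_of (universal_simplex p)))"
proof (induction p rule: less_induct)
  case (less p)
  show ?case
  proof (cases p)
  case 0
  have "singular_simplex 0 (cylinder 0) (simplex_map 0 (Pair s) (universal_simplex 0))"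
    if "s \<in> {0..1}" for s :: real
    unfolding cylinder_def
    by (rule singular_simplex_simplex_map [OF singular_universal_simplex continuous_map_slice [OF that]])
  then have "\<exists>e. singular_chain (Suc 0) (cylinder 0) e \<and>
     chain_boundary (Suc 0) e = frag_of (simplex_map 0 (Pair 1) (universal_simplex 0)) -
       frag_of (simplex_map 0 (Pair 0) (universal_simplex 0))"
    by (intro contractible_cycle_is_boundary contractible_cylinder exI conjI)
       (auto simp: singular_chain_of chain_boundary_def intro!: singular_chain_diff)
  from someI_ex [OF this] show ?thesis
    by (simp add: 0 chain_boundary_def [of 0])
next
  case (Suc r)
  have IH: "singular_chain (Suc r) (cylinder r) (universal_prism r)"
  and IH': "chain_boundary (Suc r) (universal_prism r) =
     frag_of (simplex_map r (Pair 1) (universal_simplex r)) -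
     frag_of (simplex_map r (Pair 0) (universal_simplex r)) -
     prism (r - 1) (universal_prism (r - 1)) (chain_boundary r (frag_of (universal_simplex r)))"
    using less.IH [of r] Suc by auto
  let ?q = "Suc r"
  let ?u = "frag_of (universal_simplex ?q)"
  let ?D = "subtopology (powertop_real UNIV) (standard_simplex ?q)"
  let ?z = "chain_map ?q (Pair 1) ?u - chain_map ?q (Pair 0) ?u
     - prism r (universal_prism r) (chain_boundary ?q ?u)"
  have u: "singular_chain ?q ?D ?u"
    by (simp add: singular_chain_of singular_universal_simplex)
  have bu: "singular_chain r ?D (chain_boundary ?q ?u)"
    using u by (rule singular_chain_boundary_alt)
  have U: "r > 0 \<Longrightarrow> singular_chain r (cylinder (r - 1)) (universal_prism (r - 1))"
    using less.IH [of "r - 1"] Suc by auto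
  have bb: "chain_boundary r (chain_boundary ?q ?u) = 0"
    using chain_boundary_boundary_alt [OF u] by simp
  \<comment> \<open>The prism over the double boundary vanishes, and what is left cancels the
    boundaries of the two ends, so \<open>?z\<close> is a cycle.\<close>
  have "chain_boundary ?q (prism r (universal_prism r) (chain_boundary ?q ?u))
      = chain_map r (Pair 1) (chain_boundary ?q ?u) - chain_map r (Pair 0) (chain_boundary ?q ?u)"
    using chain_boundary_prism_aux [OF IH U IH' bu] by (simp add: bb)
  then have "chain_boundary ?q ?z = 0"
    using chain_boundary_chain_map [OF u, of "Pair (1::real)"] chain_boundary_chain_map [OF u, of "Pair (0::real)"]
    by (simp add: chain_boundary_diff)
  moreover have "singular_chain ?q (cylinder ?q) ?z"
    unfolding cylinder_def
    by (intro singular_chain_diff singular_chain_chain_map [OF u] continuous_map_slice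
        singular_chain_prism [OF IH bu]) auto
  ultimately have "\<exists>e. singular_chain (Suc ?q) (cylinder ?q) e \<and> chain_boundary (Suc ?q) e = ?z"
    by (intro contractible_cycle_is_boundary contractible_cylinder) auto
  from someI_ex [OF this] show ?thesis
    by (simp add: Suc)
  qed
qed

lemma chain_boundary_prism:
  assumes "singular_chain p X c"
  shows "chain_boundary (Suc p) (prism p (universal_prism p) c)
    = chain_map p (Pair 1) c - chain_map p (Pair 0) c
      - prism (p - 1) (universal_prism (p - 1)) (chain_boundary p c)"
proof (rule chain_boundary_prism_aux)
  show "singular_chain p (cylinder (p - 1)) (universal_prism (p - 1))" if "p > 0"
    using universal_prism [of "p - 1"] that by simp
qed (use assms universal_prism in blast)+

text \<open>The homotopy \<open>h\<close> turns prisms into a chain homotopy between the chain maps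
  of \<open>f\<close> and \<open>g\<close>. Evaluating \<open>c\<close> on the prisms over simplices
  of dimension \<open>p - 1\<close> gives the cochain \<open>?w\<close>, whose coboundary is the
  difference of the two pullbacks.\<close>

lemma homotopic_cochain_pullback:
  assumes hom: "homotopic_with (\<lambda>_. True) X Y f g" and c: "c \<in> carrier (cocycle_group p Y)"
  shows "cohomology_class p X (cochain_pullback p X f c) = cohomology_class p X (cochain_pullback p X g c)"
proof -
  obtain h where h: "continuous_map (prod_topology (top_of_set {0..1::real}) X) Y h"
    and h0: "\<And>x. h (0, x) = f x" and h1: "\<And>x. h (1, x) = g x"
    using hom by (auto simp: homotopic_with_def)
  let ?P = "\<lambda>q. prism q (universal_prism q)"
  let ?w = "\<lambda>q s. if singular_simplex q X s then cochain_eval c (chain_map (Suc q) h (?P q (frag_of s))) else 0"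
  have w: "cochain_eval (?w q) a = cochain_eval c (chain_map (Suc q) h (?P q a))"
    if "singular_chain q X a" for q a
    using that unfolding singular_chain_def
    by (induction a rule: frag_induction) (auto simp: cochain_eval_diff prism_diff chain_map_diff simp del: prism_of)
  have f: "f = h \<circ> Pair 0" and g: "g = h \<circ> Pair 1"
    using h0 h1 by auto
  \<comment> \<open>Of the two terms in the chain homotopy formula, the boundary of the prism over
    \<open>s\<close> contributes nothing because \<open>c\<close> is a cocycle. Signs disappear
    modulo two.\<close>
  have key: "cochain_pullback p X g c s = cochain_pullback p X f c s
      + cochain_eval c (chain_map p h (?P (p - 1) (chain_boundary p (frag_of s))))"
    if s: "singular_simplex p X s" for s
  proof -
    let ?s = "frag_of s"
    have sc: "singular_chain p X ?s"
      using s by (simp add: singular_chain_of)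
    have "chain_map p (Pair 1) ?s - chain_map p (Pair 0) ?s
        = chain_boundary (Suc p) (?P p ?s) + ?P (p - 1) (chain_boundary p ?s)"
      using chain_boundary_prism [OF sc] by simp
    then have "chain_map p h (chain_map p (Pair 1) ?s) - chain_map p h (chain_map p (Pair 0) ?s)
        = chain_map p h (chain_boundary (Suc p) (?P p ?s)) + chain_map p h (?P (p - 1) (chain_boundary p ?s))"
      by (metis chain_map_add chain_map_diff)
    moreover have pp: "singular_chain (Suc p) (prod_topology (top_of_set {0..1}) X) (?P p ?s)"
      using singular_chain_prism universal_prism sc by blast
    then have "chain_map p h (chain_boundary (Suc p) (?P p ?s))
        = chain_boundary (Suc p) (chain_map (Suc p) h (?P p ?s))"
      using chain_boundary_chain_map [OF pp, of h] by simp
    moreover have "cochain_eval c (chain_boundary (Suc p) (chain_map (Suc p) h (?P p ?s))) = 0"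
      using cochain_eval_coboundary [OF singular_chain_chain_map [OF pp h], of c] c
      by (simp add: cocycle_group_def cochain_eval_def)
    ultimately have "cochain_eval c (chain_map p g ?s) - cochain_eval c (chain_map p f ?s)
        = cochain_eval c (chain_map p h (?P (p - 1) (chain_boundary p ?s)))"
      unfolding f g chain_map_compose o_apply
      by (metis (no_types) add_0 cochain_eval_add cochain_eval_diff)
    then show ?thesis
      using s by (simp add: cochain_pullback_def) (metis add.commute bit_add_self add.assoc add_0)
  qed
  show ?thesis
  proof (cases p)
    case 0
    \<comment> \<open>A 0-simplex has zero boundary, so the correction in \<open>key\<close>
      vanishes and the pullbacks agree as cochains.\<close>
    have "cochain_pullback p X g c = cochain_pullback p X f c"
      by (rule cochain_eqI [OF pullback_in_cochains pullback_in_cochains])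
         (simp add: key, simp add: 0 chain_boundary_def)
    then show ?thesis by simp
  next
    case (Suc q)
    let ?b = "coboundary q X (?w q)"
    have "cochain_pullback p X g c = (\<lambda>s. ?b s + cochain_pullback p X f c s)"
    proof (rule cochain_eqI [OF pullback_in_cochains])
      show "(\<lambda>s. ?b s + cochain_pullback p X f c s) \<in> cochains p X"
        unfolding Suc by (intro add_in_cochains) auto
      fix s assume s: "singular_simplex p X s"
      then have "singular_chain q X (chain_boundary p (frag_of s))"
        by (simp add: Suc singular_chain_boundary_alt singular_chain_of)
      from w [OF this] s show "cochain_pullback p X g c s = ?b s + cochain_pullback p X f c s"
        by (simp add: key) (simp add: Suc coboundary_simplex add.commute)
    qed
    moreover have "?b \<in> coboundaries p X"
      unfolding Suc coboundaries_Suc by (rule imageI) (simp add: cochains_def)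
    ultimately show ?thesis
      by (simp add: cohomology_class_add)
  qed
qed

lemma homotopic_cohomology_pullback:
  assumes hom: "homotopic_with (\<lambda>_. True) X Y f g" and w: "w \<in> carrier (cohomology_group p Y)"
  shows "cohomology_pullback p X f w = cohomology_pullback p X g w"
proof -
  have "continuous_map X Y f" "continuous_map X Y g"
    using hom homotopic_with_imp_continuous_maps by blast+
  with w show ?thesis
    using homotopic_cochain_pullback [OF hom]
    by (auto simp: carrier_cohomology_group cohomology_pullback_class)
qed

text \<open>Pullback along \<open>g\<close> is the inverse, by homotopy invariance on one side.
  Asking \<open>g\<close> to be an exact left inverse, rather than one up to homotopy, also makes
  \<open>f\<close> injective, which is what multiplicativity rests on.\<close>

lemma cohomology_iso_section_deformation:
  assumes f: "continuous_map X Y f" and g: "continuous_map Y X g"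
    and gf: "\<And>x. x \<in> topspace X \<Longrightarrow> g (f x) = x"
    and hom: "homotopic_with (\<lambda>_. True) Y Y (f \<circ> g) id"
  shows "cohomology_iso Y X (\<lambda>p. cohomology_pullback p X f)"
proof -
  have inj: "inj_on f (topspace X)"
    by (metis gf inj_onI)
  have "bij_betw (cohomology_pullback p X f) (carrier (cohomology_group p Y)) (carrier (cohomology_group p X))" for p
  proof (rule bij_betwI)
    fix w assume w: "w \<in> carrier (cohomology_group p Y)"
    show "cohomology_pullback p Y g (cohomology_pullback p X f w) = w"
      by (simp add: cohomology_pullback_compose [OF g] homotopic_cohomology_pullback [OF hom w]
          cohomology_pullback_id [OF w])
  next
    fix w assume w: "w \<in> carrier (cohomology_group p X)"
    have "cohomology_pullback p X (g \<circ> f) w = cohomology_pullback p X id w"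
      by (rule cohomology_pullback_cong) (simp add: gf)
    then show "cohomology_pullback p X f (cohomology_pullback p Y g w) = w"
      by (simp add: cohomology_pullback_compose [OF f] cohomology_pullback_id [OF w])
  qed (use cohomology_pullback_hom [OF f] cohomology_pullback_hom [OF g] in \<open>auto simp: hom_def\<close>)
  then show ?thesis
    unfolding cohomology_iso_def iso_def
    using cohomology_pullback_hom [OF f] cohomology_pullback_unit [OF f] cohomology_pullback_cup [OF f inj]
    by blast
qed

section \<open>The medial axis of the Grassmannian\<close>

definition outer :: "real^'m \<Rightarrow> real^'m \<Rightarrow> real^'m^'m" where
  "outer x y = (\<chi> i j. x $ i * y $ j)"

lemma outer_mult_vec [simp]: "outer x y *v z = (y \<bullet> z) *\<^sub>R x"
  by (simp add: outer_def matrix_vector_mult_def vec_eq_iff inner_vec_def sum_distrib_left mult.assoc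
      mult.left_commute mult.commute)

lemma inner_outer [simp]: "A \<bullet> outer x y = x \<bullet> (A *v y)"
  by (simp add: outer_def matrix_vector_mult_def inner_vec_def sum_distrib_left mult.assoc
      mult.left_commute mult.commute)

lemma outer_inner [simp]: "outer x y \<bullet> A = x \<bullet> (A *v y)"
  by (simp add: inner_commute [of "outer x y"])

definition orthonormal :: "'a::real_inner set \<Rightarrow> bool" where
  "orthonormal S \<longleftrightarrow> finite S \<and> (\<forall>x\<in>S. \<forall>y\<in>S. x \<bullet> y = (if x = y then 1 else 0))"

definition proj_matrix :: "(real^'m) set \<Rightarrow> real^'m^'m" where
  "proj_matrix S = (\<Sum>b\<in>S. outer b b)"

lemma orthonormal_subset: "orthonormal S \<Longrightarrow> T \<subseteq> S \<Longrightarrow> orthonormal T"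
  unfolding orthonormal_def by (meson finite_subset subsetD)

lemma orthonormal_insert:
  assumes "orthonormal S" "norm e = 1" "\<And>x. x \<in> S \<Longrightarrow> e \<bullet> x = 0"
  shows "orthonormal (insert e S)" and "e \<notin> S"
proof -
  have ee: "e \<bullet> e = 1"
    using assms(2) by (simp add: norm_eq_1)
  then show "e \<notin> S"
    using assms(3) by force
  then show "orthonormal (insert e S)"
    using assms ee by (auto simp: orthonormal_def inner_commute)
qed

lemma subspace_orthonormal_basis:
  fixes V :: "'a::euclidean_space set"
  assumes "subspace V"
  obtains S where "orthonormal S" "card S = dim V" "span S = V"
proof -
  obtain S where "S \<subseteq> V" and S: "pairwise orthogonal S" "\<And>x. x \<in> S \<Longrightarrow> norm x = 1"
    "independent S" "card S = dim V" "span S = V"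
    by (rule orthonormal_basis_subspace [OF assms]) (rule that)
  have "x \<bullet> y = (if x = y then 1 else 0)" if "x \<in> S" "y \<in> S" for x y
    using S(1) S(2) [OF that(1)] that by (auto simp: norm_eq_1 pairwise_def orthogonal_def)
  then have "orthonormal S"
    by (simp add: orthonormal_def independent_imp_finite [OF S(3)])
  with S(4,5) show ?thesis
    using that by blast
qed

lemma dim_span_orthonormal:
  fixes S :: "'a::euclidean_space set"
  assumes "orthonormal S"
  shows "dim (span S) = card S"
proof -
  have "independent S"
    by (rule pairwise_orthogonal_independent)
       (use assms inner_zero_left zero_neq_one in \<open>(simp add: orthonormal_def pairwise_def orthogonal_def; metis)+\<close>)
  then show ?thesis
    by (simp add: dim_eq_card_independent)
qed

lemma proj_matrix_mult: "proj_matrix S *v x = (\<Sum>b\<in>S. (b \<bullet> x) *\<^sub>R b)"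
  unfolding proj_matrix_def
  by (induction S rule: infinite_finite_induct) (simp_all add: matrix_vector_mult_add_rdistrib)

lemma proj_matrix_sym: "x \<bullet> (proj_matrix S *v y) = (proj_matrix S *v x) \<bullet> y"
  by (simp add: proj_matrix_mult inner_sum_left inner_sum_right inner_commute mult.commute)

lemma inner_proj_matrix: "A \<bullet> proj_matrix S = (\<Sum>b\<in>S. b \<bullet> (A *v b))"
  by (simp add: proj_matrix_def inner_sum_right)

lemma proj_matrix_in_span: "proj_matrix S *v x \<in> span S"
  by (simp add: proj_matrix_mult span_base span_scale span_sum)

lemma proj_matrix_residual:
  assumes "orthonormal S" "y \<in> span S"
  shows "(x - proj_matrix S *v x) \<bullet> y = 0"
proof -
  have "orthogonal (x - proj_matrix S *v x) b" if b: "b \<in> S" for b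
  proof -
    have "(proj_matrix S *v x) \<bullet> b = (\<Sum>a\<in>S. if a = b then b \<bullet> x else 0)"
      unfolding proj_matrix_mult inner_sum_left
      by (rule sum.cong) (use assms b in \<open>auto simp: orthonormal_def\<close>)
    then show ?thesis
      using b assms
      by (simp add: orthonormal_def orthogonal_def inner_diff_left inner_diff_right inner_commute)
  qed
  then show ?thesis
    using orthogonal_to_span [OF assms(2)] by (simp add: orthogonal_def)
qed

lemma proj_matrix_span:
  assumes "orthonormal S" "x \<in> span S"
  shows "proj_matrix S *v x = x"
proof -
  have "x - proj_matrix S *v x \<in> span S"
    by (simp add: assms(2) proj_matrix_in_span span_diff)
  from proj_matrix_residual [OF assms(1) this, of x] show ?thesis by simp
qed

lemma proj_matrix_orthogonal:
  assumes "\<And>b. b \<in> S \<Longrightarrow> b \<bullet> x = 0"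
  shows "proj_matrix S *v x = 0"
  by (simp add: proj_matrix_mult assms)

lemma orthogonal_projection_unique:
  assumes "subspace V" "orthogonal_projection_onto P V" "orthogonal_projection_onto Q V"
  shows "P = Q"
proof -
  have "P *v x = Q *v x" for x
  proof -
    have 1: "P *v x - Q *v x \<in> V"
      using assms by (simp add: orthogonal_projection_onto_def subspace_diff)
    have "(x - P *v x) \<bullet> (P *v x - Q *v x) = 0" "(x - Q *v x) \<bullet> (P *v x - Q *v x) = 0"
      using assms(2,3) 1 unfolding orthogonal_projection_onto_def by blast+
    then have "((x - Q *v x) - (x - P *v x)) \<bullet> (P *v x - Q *v x) = 0"
      unfolding inner_diff_left by linarith
    then show ?thesis by simp
  qed
  then show ?thesis
    by (simp add: matrix_eq)
qed

lemma orthogonal_projection_proj_matrix: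
  "orthonormal S \<Longrightarrow> orthogonal_projection_onto (proj_matrix S) (span S)"
  by (simp add: orthogonal_projection_onto_def proj_matrix_in_span proj_matrix_residual)

text \<open>A projection depends only on its plane, so a basis adapted to a chosen unit vector may
  replace any other; the exchange argument relies on this freedom.\<close>

lemma proj_matrix_cong:
  "orthonormal S \<Longrightarrow> orthonormal T \<Longrightarrow> span S = span T \<Longrightarrow> proj_matrix S = proj_matrix T"
  using orthogonal_projection_unique [OF subspace_span] orthogonal_projection_proj_matrix by metis

lemma grassmannian_iff:
  "P \<in> grassmannian d \<longleftrightarrow> (\<exists>S. orthonormal S \<and> card S = d \<and> P = proj_matrix S)"
proof
  assume "P \<in> grassmannian d"
  then obtain V where V: "subspace V" "dim V = d" "orthogonal_projection_onto P V"
    by (auto simp: grassmannian_def)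
  obtain S where S: "orthonormal S" "card S = dim V" "span S = V"
    by (rule subspace_orthonormal_basis [OF V(1)]) (rule that)
  then have "P = proj_matrix S"
    using orthogonal_projection_unique [OF V(1,3)] orthogonal_projection_proj_matrix [OF S(1)] by simp
  with S V show "\<exists>S. orthonormal S \<and> card S = d \<and> P = proj_matrix S" by metis
next
  assume "\<exists>S. orthonormal S \<and> card S = d \<and> P = proj_matrix S"
  then show "P \<in> grassmannian d"
    unfolding grassmannian_def
    using dim_span_orthonormal orthogonal_projection_proj_matrix subspace_span by blast
qed

lemma proj_matrix_inner_subset:
  assumes "orthonormal S" "T \<subseteq> S"
  shows "proj_matrix T \<bullet> proj_matrix S = card T"
proof -
  have "proj_matrix T \<bullet> proj_matrix S = (\<Sum>b\<in>T. b \<bullet> (proj_matrix S *v b))"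
    by (subst inner_commute) (rule inner_proj_matrix)
  also have "\<dots> = (\<Sum>b\<in>T. 1)"
  proof (rule sum.cong)
    fix b assume "b \<in> T"
    then show "b \<bullet> (proj_matrix S *v b) = 1"
      using assms by (auto simp: proj_matrix_span span_base orthonormal_def)
  qed simp
  finally show ?thesis by simp
qed

text \<open>For a unit vector \<open>b\<close> with projection \<open>y\<close>, orthogonality of
  the residual gives \<open>b \<bullet> y = y \<bullet> y\<close>, so
  \<open>1 - b \<bullet> y\<close> is the squared norm of \<open>b - y\<close>. Summing over
  \<open>S\<close> gives the bound.\<close>

lemma proj_matrix_inner_le:
  assumes "orthonormal S" "orthonormal T"
  shows "proj_matrix S \<bullet> proj_matrix T \<le> card S"
proof -
  have "b \<bullet> (proj_matrix T *v b) \<le> 1" if "b \<in> S" for b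
  proof -
    let ?y = "proj_matrix T *v b"
    have "(b - ?y) \<bullet> ?y = 0"
      by (rule proj_matrix_residual [OF assms(2) proj_matrix_in_span])
    moreover have "0 \<le> (b - ?y) \<bullet> (b - ?y)" by simp
    moreover have "b \<bullet> b = 1"
      using assms(1) that by (simp add: orthonormal_def)
    ultimately show ?thesis
      by (simp add: inner_diff_left inner_diff_right inner_commute)
  qed
  then have "(\<Sum>b\<in>S. b \<bullet> (proj_matrix T *v b)) \<le> (\<Sum>b\<in>S. 1)"
    by (rule sum_mono)
  then show ?thesis
    by (subst inner_commute) (simp add: inner_proj_matrix)
qed

text \<open>Every projection of rank \<open>d\<close> has squared norm \<open>d\<close>, so only the
  inner product with \<open>A\<close> distinguishes their distances to \<open>A\<close>.\<close>

lemma dist_grassmannian_le_iff: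
  fixes A :: "real^'m^'m"
  assumes "P \<in> grassmannian d" "Q \<in> grassmannian d"
  shows "dist A P \<le> dist A Q \<longleftrightarrow> A \<bullet> Q \<le> A \<bullet> P"
proof -
  have "R \<bullet> R = d" if "R \<in> grassmannian d" for R :: "real^'m^'m"
    using that proj_matrix_inner_subset by (auto simp: grassmannian_iff)
  then show ?thesis
    using assms by (simp add: dist_norm norm_le inner_diff_left inner_diff_right inner_commute)
qed

text \<open>The complement of \<open>Z\<close> and \<open>X\<close> have dimensions adding up to
  more than that of the space, so they meet. This count replaces a min-max principle for eigenvalues
  when signs of a form on two subspaces are compared.\<close>

lemma exists_orthogonal_in_subspace:
  fixes X Z :: "'a::euclidean_space set"
  assumes "subspace X" "subspace Z" "dim Z < dim X"
  obtains x where "x \<in> X" "x \<noteq> 0" "\<And>z. z \<in> Z \<Longrightarrow> z \<bullet> x = 0"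
proof -
  let ?W = "{y. \<forall>z\<in>Z. orthogonal z y}"
  have W: "subspace ?W"
    by (rule subspace_orthogonal_to_vectors)
  have "dim ?W + dim Z = DIM('a)"
    using dim_subspace_orthogonal_to_vectors [OF assms(2) subspace_UNIV] by (simp add: dim_UNIV)
  moreover have "dim {x + y |x y. x \<in> ?W \<and> y \<in> X} + dim (?W \<inter> X) = dim ?W + dim X"
    by (rule dim_sums_Int [OF W assms(1)])
  moreover have "dim {x + y |x y. x \<in> ?W \<and> y \<in> X} \<le> DIM('a)"
    by (rule dim_subset_UNIV)
  ultimately have "dim (?W \<inter> X) \<noteq> 0"
    using assms(3) by linarith
  then show ?thesis
    using that by (auto simp: dim_eq_0 orthogonal_def)
qed

text \<open>Such a resolution of the identity allows a trace to be computed along the plane of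
  \<open>S\<close> and its complement.\<close>

lemma orthonormal_complement:
  fixes S :: "(real^'m) set"
  assumes "orthonormal S"
  obtains C where "orthonormal C" "\<And>c s. c \<in> C \<Longrightarrow> s \<in> span S \<Longrightarrow> s \<bullet> c = 0"
    "proj_matrix S + proj_matrix C = mat 1"
proof -
  let ?W = "{y. \<forall>z\<in>span S. orthogonal z y}"
  obtain C where C: "orthonormal C" "span C = ?W"
    by (rule subspace_orthonormal_basis [OF subspace_orthogonal_to_vectors]) (rule that)
  have perp: "s \<bullet> c = 0" if "c \<in> C" "s \<in> span S" for c s
    using that C(2) span_base [of c C] by (auto simp: orthogonal_def)
  have "(proj_matrix S + proj_matrix C) *v x = mat 1 *v x" for x
  proof -
    let ?y = "x - proj_matrix S *v x"
    have "?y \<in> span C"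
      unfolding C(2) using proj_matrix_residual [OF assms]
      by (simp add: orthogonal_def inner_commute)
    then have "proj_matrix C *v ?y = ?y"
      by (rule proj_matrix_span [OF C(1)])
    moreover have "proj_matrix C *v (proj_matrix S *v x) = 0"
      by (rule proj_matrix_orthogonal) (metis perp proj_matrix_in_span inner_commute)
    ultimately show ?thesis
      by (simp add: matrix_vector_mult_add_rdistrib matrix_vector_mult_diff_distrib)
  qed
  then have "proj_matrix S + proj_matrix C = mat 1"
    by (simp add: matrix_eq)
  with C(1) perp that show ?thesis by blast
qed

section \<open>A point of the medial axis at the critical distance\<close>

lemma medial_axis_grassmannian_near:
  fixes P :: "real^'m^'m"
  assumes P: "P \<in> grassmannian d" and d: "1 \<le> d" "d < CARD('m)"
  obtains A where "A \<in> medial_axis (grassmannian d)" "dist P A = sqrt 2 / 2"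
proof -
  obtain S where S: "orthonormal S" "card S = d" "P = proj_matrix S"
    using P  by (auto simp: grassmannian_iff)
  obtain e where e: "e \<in> S"
    using S d by fastforce
  have "dim (span S) < DIM(real^'m)"
    using S d by (simp add: dim_span_orthonormal del: dim_span)
  then obtain x where x: "x \<noteq> 0" "\<And>y. y \<in> span S \<Longrightarrow> orthogonal x y"
    using orthogonal_to_subspace_exists [of S] by (metis dim_span)
  define f where "f = x /\<^sub>R norm x"
  have f: "norm f = 1" "\<And>y. y \<in> S \<Longrightarrow> f \<bullet> y = 0"
    using x by (auto simp: f_def orthogonal_def span_base)
  have Sf: "orthonormal (insert f S)" "f \<notin> S"
    using orthonormal_insert [OF S(1) f] by auto
  have Se: "orthonormal (S - {e})"
    by (rule orthonormal_subset [OF S(1)]) auto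
  have Q: "orthonormal (insert f (S - {e}))"
    by (rule orthonormal_subset [OF Sf(1)]) auto
  have fin: "finite S"
    using S(1) by (simp add: orthonormal_def)
  have ef: "e \<bullet> e = 1" "f \<bullet> f = 1" "e \<bullet> f = 0"
    using e S(1) f by (auto simp: orthonormal_def norm_eq_1 inner_commute)
  have card: "card (S - {e}) = d - 1" "card (insert f (S - {e})) = d" "card (insert f S) = d + 1"
  proof -
    show 1: "card (S - {e}) = d - 1"
      using e S(2) by simp
    show "card (insert f (S - {e})) = d"
      using fin Sf(2) d 1 by simp
    show "card (insert f S) = d + 1"
      using fin Sf(2) S(2) by simp
  qed
  define Q where "Q = proj_matrix (insert f (S - {e}))"
  \<comment> \<open>\<open>A\<close> is the midpoint of \<open>P\<close> and \<open>Q\<close>, with eigenvalues \<open>1\<close>, \<open>1/2\<close> (twice) and \<open>0\<close>. As a mean of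
    projections of ranks \<open>d - 1\<close> and \<open>d + 1\<close> it is easy to pair with a projection of rank \<open>d\<close>.\<close>
  define A where "A = (1/2) *\<^sub>R (proj_matrix (S - {e}) + proj_matrix (insert f S))"
  have QG: "Q \<in> grassmannian d"
    using Q card unfolding grassmannian_iff Q_def by blast
  have "proj_matrix (S - {e}) \<bullet> P = real (d - 1)"
    unfolding S(3) card(1) [symmetric] by (rule proj_matrix_inner_subset [OF S(1)]) auto
  moreover have "proj_matrix (insert f S) \<bullet> P = real d"
    unfolding S(3) inner_commute [of "proj_matrix (insert f S)"] S(2) [symmetric]
    by (rule proj_matrix_inner_subset [OF Sf(1)]) auto
  ultimately have AP: "A \<bullet> P = d - 1 / 2"
    using d by (simp add: A_def inner_add_left of_nat_diff)
  have "proj_matrix (S - {e}) \<bullet> Q = real (d - 1)"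
    unfolding Q_def card(1) [symmetric] by (rule proj_matrix_inner_subset [OF Q]) auto
  moreover have "proj_matrix (insert f S) \<bullet> Q = real d"
    unfolding Q_def inner_commute [of "proj_matrix (insert f S)"] card(2) [symmetric]
    by (rule proj_matrix_inner_subset [OF Sf(1)]) auto
  ultimately have AQ: "A \<bullet> Q = d - 1 / 2"
    using d by (simp add: A_def inner_add_left of_nat_diff)
  have AR: "A \<bullet> R \<le> d - 1 / 2" if R: "R \<in> grassmannian d" for R :: "real^'m^'m"
  proof -
    obtain T where T: "orthonormal T" "card T = d" "R = proj_matrix T"
      using R by (auto simp: grassmannian_iff)
    have "proj_matrix (S - {e}) \<bullet> R \<le> real (d - 1)"
      using proj_matrix_inner_le [OF Se T(1)] by (simp only: T(3) card(1))
    \<comment> \<open>The factors are swapped so that the bound is the rank \<open>d\<close> of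
      \<open>R\<close> and not the rank \<open>d + 1\<close> of the other projection.\<close>
    moreover have "proj_matrix (insert f S) \<bullet> R \<le> real d"
      using proj_matrix_inner_le [OF T(1) Sf(1)] by (simp only: T(2,3) inner_commute)
    ultimately show ?thesis
      using d by (simp add: A_def inner_add_left of_nat_diff)
  qed
  have "P *v e = e"
    using e S by (simp add: proj_matrix_span span_base)
  moreover have "Q *v e = 0"
    unfolding Q_def
    by (rule proj_matrix_orthogonal) (use e S(1) f in \<open>auto simp: orthonormal_def\<close>)
  ultimately have "P \<noteq> Q"
    using ef by auto
  moreover have "dist A P \<le> dist A R" "dist A Q \<le> dist A R" if "R \<in> grassmannian d" for R
    using AP AQ AR [OF that] dist_grassmannian_le_iff [OF P that] dist_grassmannian_le_iff [OF QG that]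
    by auto
  ultimately have A: "A \<in> medial_axis (grassmannian d)"
    unfolding medial_axis_def using P QG by blast
  have "P - A = (1/2) *\<^sub>R (outer e e - outer f f)"
  proof -
    have "proj_matrix S = outer e e + proj_matrix (S - {e})"
      "proj_matrix (insert f S) = outer f f + proj_matrix S"
      using fin e Sf(2) by (auto simp: proj_matrix_def sum.remove)
    then show ?thesis
      by (simp add: A_def S(3) vec_eq_iff field_simps)
  qed
  \<comment> \<open>A quarter of 2, the squared norm of
    \<open>outer e e - outer f f\<close>.\<close>
  then have "(P - A) \<bullet> (P - A) = 1 / 2"
    using ef by (simp add: inner_diff_left inner_diff_right inner_commute)
  then have "dist P A = sqrt (1/2)"
    by (simp add: dist_norm norm_eq_sqrt_inner)
  moreover have "sqrt (1/2) = sqrt 2 / 2"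
    by (rule real_sqrt_unique) (simp_all add: power_divide)
  ultimately have "dist P A = sqrt 2 / 2"
    by simp
  with A show ?thesis
    by (rule that)
qed

lemma orthonormal_basis_with:
  fixes V :: "'a::euclidean_space set"
  assumes V: "subspace V" and e: "e \<in> V" "norm e = 1"
  obtains S where "orthonormal (insert e S)" "e \<notin> S" "span (insert e S) = V"
    "span S = {y\<in>V. e \<bullet> y = 0}"
proof -
  let ?W = "{y\<in>V. e \<bullet> y = 0}"
  have "subspace ?W"
    using V by (auto simp: subspace_def inner_add_right)
  then obtain S where S: "orthonormal S" "span S = ?W"
    by (rule subspace_orthonormal_basis) (rule that)
  have perp: "e \<bullet> x = 0" and inV: "x \<in> V" if "x \<in> S" for x
    using span_base [OF that] S(2) by auto
  have "x \<in> span (insert e S)" if "x \<in> V" for x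
  proof -
    have "x - (e \<bullet> x) *\<^sub>R e \<in> span S"
      using that e V unfolding S(2)
      by (simp add: subspace_diff subspace_scale inner_diff_right norm_eq_1)
    then show ?thesis
      by (simp add: span_insert) blast
  qed
  moreover have "span (insert e S) \<subseteq> V"
    by (rule span_minimal) (use e inV V in auto)
  ultimately show ?thesis
    using orthonormal_insert [OF S(1) e(2) perp] S(2) that by blast
qed

section \<open>Order and cross conditions at a maximizer\<close>

context
  fixes A :: "real^'m^'m" and T :: "(real^'m) set" and d :: nat
  assumes T: "orthonormal T" "card T = d"
    and max: "\<And>R. R \<in> grassmannian d \<Longrightarrow> A \<bullet> R \<le> A \<bullet> proj_matrix T"
begin

text \<open>Complete \<open>e\<close> to an orthonormal basis of the plane and replace it by
  \<open>g\<close>, which is still orthogonal to the other vectors. The result is a competitor of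
  rank \<open>d\<close>, and the common terms cancel. Taking \<open>a = 0\<close> exchanges
  \<open>e\<close> for \<open>f\<close>; other values rotate \<open>e\<close> towards the
  complement.\<close>

lemma maximal_exchange:
  assumes e: "e \<in> span T" "norm e = 1" and f: "\<And>x. x \<in> span T \<Longrightarrow> f \<bullet> x = 0"
  shows "g = a *\<^sub>R e + f \<Longrightarrow> norm g = 1 \<Longrightarrow> g \<bullet> (A *v g) \<le> e \<bullet> (A *v e)"
proof -
  assume g: "g = a *\<^sub>R e + f" "norm g = 1"
  obtain S where S: "orthonormal (insert e S)" "e \<notin> S" "span (insert e S) = span T"
    "span S = {y \<in> span T. e \<bullet> y = 0}"
    by (rule orthonormal_basis_with [OF subspace_span e]) (rule that)
  have oS: "orthonormal S"
    using S(1) orthonormal_subset by blast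
  have "g \<bullet> x = 0" if "x \<in> S" for x
    using span_base [OF that] S(4) f g by (auto simp: inner_add_left)
  then have g': "orthonormal (insert g S)" "g \<notin> S"
    using orthonormal_insert [OF oS g(2)] by blast+
  have fin: "finite S"
    using oS by (simp add: orthonormal_def)
  have "card (insert e S) = d"
    using dim_span_orthonormal [OF S(1)] dim_span_orthonormal [OF T(1)] S(3) T(2) by simp
  then have "card (insert g S) = d"
    using fin S(2) g'(2) by simp
  then have "A \<bullet> proj_matrix (insert g S) \<le> A \<bullet> proj_matrix T"
    using g'(1) by (intro max) (auto simp: grassmannian_iff)
  moreover have "proj_matrix T = proj_matrix (insert e S)"
    using proj_matrix_cong [OF T(1) S(1)] S(3) by simp
  ultimately show ?thesis
    using fin S(2) g'(2) by (simp add: inner_proj_matrix)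
qed

lemma maximal_order:
  assumes "e \<in> span T" "norm e = 1" "\<And>x. x \<in> span T \<Longrightarrow> f \<bullet> x = 0" "norm f = 1"
  shows "f \<bullet> (A *v f) \<le> e \<bullet> (A *v e)"
  by (rule maximal_exchange [OF assms(1-3), where a = 0]) (use assms in auto)

text \<open>This is the stationarity of the functional when \<open>e\<close> is rotated towards
  \<open>f\<close>. Both mixed terms occur because \<open>A\<close> need not be symmetric. Instead
  of differentiating, finite rotations are compared with the maximum.\<close>

lemma maximal_cross:
  assumes x: "x \<in> span T" and y: "\<And>x. x \<in> span T \<Longrightarrow> y \<bullet> x = 0"
  shows "x \<bullet> (A *v y) + y \<bullet> (A *v x) = 0"
proof (cases "x = 0 \<or> y = 0")
  case False
  define e f where "e = x /\<^sub>R norm x" and "f = y /\<^sub>R norm y"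
  have e: "e \<in> span T" "norm e = 1" and f: "\<And>x. x \<in> span T \<Longrightarrow> f \<bullet> x = 0" "norm f = 1"
    using False x y by (auto simp: e_def f_def span_scale)
  have ef: "e \<bullet> e = 1" "f \<bullet> f = 1" "e \<bullet> f = 0" "f \<bullet> e = 0"
    using e f by (auto simp: norm_eq_1 inner_commute)
  define K L where "K = e \<bullet> (A *v f) + f \<bullet> (A *v e)" and "L = e \<bullet> (A *v e) - f \<bullet> (A *v f)"
  have L: "L \<ge> 0"
    using maximal_order [OF e f] by (simp add: L_def)
  \<comment> \<open>The competitor is \<open>e + s *\<^sub>R f\<close> normalized by its length
    \<open>r\<close>; multiplying the comparison by the square of \<open>r\<close> clears the
    denominator.\<close>
  have *: "s * K \<le> s\<^sup>2 * L" for s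
  proof -
    define r where "r = sqrt (1 + s\<^sup>2)"
    have r: "r > 0" "r\<^sup>2 = 1 + s\<^sup>2"
      by (auto simp: r_def add_pos_nonneg)
    define g where "g = (1 / r) *\<^sub>R e + (s / r) *\<^sub>R f"
    have rg: "r *\<^sub>R g = e + s *\<^sub>R f"
      using r by (simp add: g_def scaleR_right_distrib)
    have "g \<bullet> g = (1 + s\<^sup>2) / r\<^sup>2"
      by (simp add: g_def inner_add_left inner_add_right ef power2_eq_square add_divide_distrib)
    also have "\<dots> = 1"
      unfolding r(2) [symmetric] using r(1) by simp
    finally have "norm g = 1"
      by (simp add: norm_eq_1)
    then have "g \<bullet> (A *v g) \<le> e \<bullet> (A *v e)"
      by (intro maximal_exchange [OF e, where f = "(s / r) *\<^sub>R f" and a = "1 / r"])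
         (auto simp: g_def f)
    then have "r\<^sup>2 * (g \<bullet> (A *v g)) \<le> r\<^sup>2 * (e \<bullet> (A *v e))"
      by (intro mult_left_mono) auto
    moreover have "r\<^sup>2 * (g \<bullet> (A *v g)) = (r *\<^sub>R g) \<bullet> (A *v (r *\<^sub>R g))"
      by (simp add: matrix_vector_mult_scaleR power2_eq_square)
    moreover have "\<dots> = e \<bullet> (A *v e) + s * K + s\<^sup>2 * (f \<bullet> (A *v f))"
      unfolding rg K_def
      by (simp add: matrix_vector_right_distrib matrix_vector_mult_scaleR inner_add_left inner_add_right
          power2_eq_square algebra_simps)
    ultimately show ?thesis
      using r by (simp add: L_def algebra_simps)
  qed
  \<comment> \<open>The summand 1 keeps the denominator positive when \<open>L\<close> is 0. With
    this \<open>s\<close> the inequality leaves only \<open>s = 0\<close>, hence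
    \<open>K = 0\<close>.\<close>
  define s where "s = K / (L + 1)"
  have K: "K = s * (L + 1)"
    using L by (simp add: s_def)
  then have "s\<^sup>2 * (L + 1) \<le> s\<^sup>2 * L"
    using * [of s] by (simp add: power2_eq_square mult.assoc)
  then have "K = 0"
    using K by (simp add: distrib_left)
  moreover have "x = norm x *\<^sub>R e" "y = norm y *\<^sub>R f"
    using False by (auto simp: e_def f_def)
  then have "x \<bullet> (A *v y) + y \<bullet> (A *v x) = norm x * norm y * K"
    unfolding K_def
    by (metis (no_types, lifting) inner_scaleR_left inner_scaleR_right matrix_vector_mult_scaleR
        distrib_left mult.assoc mult.left_commute)
  ultimately show ?thesis by simp
qed auto

end

text \<open>At the projection itself the form is 1 at \<open>v\<close> and 0 at \<open>w\<close>.
  The deviation of \<open>A\<close> from it is paired with \<open>?N\<close>, of norm sqrt 2, so by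
  Cauchy-Schwarz it changes this gap by less than 1.\<close>

lemma quadratic_form_gap:
  fixes A :: "real^'m^'m"
  assumes S: "orthonormal S" and near: "dist A (proj_matrix S) < sqrt 2 / 2"
    and v: "v \<in> span S" "norm v = 1" and w: "\<And>x. x \<in> span S \<Longrightarrow> w \<bullet> x = 0" "norm w = 1"
  shows "w \<bullet> (A *v w) < v \<bullet> (A *v v)"
proof -
  let ?D = "A - proj_matrix S" and ?N = "outer w w - outer v v"
  have vw: "v \<bullet> v = 1" "w \<bullet> w = 1" "w \<bullet> v = 0" "v \<bullet> w = 0"
    using v w by (auto simp: norm_eq_1 inner_commute)
  have "proj_matrix S *v v = v" "proj_matrix S *v w = 0"
    using S v w by (auto simp: proj_matrix_span span_base inner_commute intro!: proj_matrix_orthogonal)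
  then have "?D \<bullet> ?N = w \<bullet> (A *v w) - v \<bullet> (A *v v) + 1"
    by (simp add: inner_diff_right inner_diff_left matrix_vector_mult_diff_rdistrib vw)
  moreover have "?D \<bullet> ?N \<le> norm ?D * norm ?N"
    by (rule norm_cauchy_schwarz)
  moreover have "?N \<bullet> ?N = 2"
    by (simp add: inner_diff_right inner_diff_left matrix_vector_mult_diff_rdistrib vw)
  then have "norm ?N = sqrt 2"
    by (simp only: norm_eq_sqrt_inner)
  moreover have "norm ?D * sqrt 2 < sqrt 2 / 2 * sqrt 2"
    by (rule mult_strict_right_mono) (use near in \<open>simp_all add: dist_norm\<close>)
  ultimately show ?thesis
    by simp
qed

text \<open>Subtracting the scalar \<open>c\<close> attained in the gap makes the quadratic form nonnegative on the \<open>d\<close>-plane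
  of \<open>S\<close> and negative on its complement. By the order and cross conditions and a dimension count, the
  same signs hold for the \<open>d\<close>-plane of the maximizer \<open>T\<close> and its complement, which forces \<open>U\<close> into the
  span of \<open>T\<close>.\<close>

lemma maximizer_unique:
  fixes A :: "real^'m^'m"
  assumes S: "orthonormal S" "card S = d" "1 \<le> d" and near: "dist A (proj_matrix S) < sqrt 2 / 2"
    and T: "orthonormal T" "card T = d"
    and max: "\<And>R. R \<in> grassmannian d \<Longrightarrow> A \<bullet> R \<le> A \<bullet> proj_matrix T"
    and U: "orthonormal U" "card U = d" and eq: "A \<bullet> proj_matrix U = A \<bullet> proj_matrix T"
  shows "proj_matrix U = proj_matrix T"
proof -
  let ?K = "sphere 0 1 \<inter> span S"
  have "continuous_on ?K (\<lambda>v. v \<bullet> (A *v v))"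
    by (intro continuous_intros matrix_vector_mult_linear_continuous_on)
  moreover have "compact ?K"
    by (intro compact_Int_closed closed_subspace) auto
  moreover obtain s where "s \<in> S"
    using S by fastforce
  then have "s \<in> ?K"
    using S(1) by (auto simp: orthonormal_def span_base norm_eq_1)
  ultimately obtain v where v: "v \<in> ?K" and vmin: "\<And>x. x \<in> ?K \<Longrightarrow> v \<bullet> (A *v v) \<le> x \<bullet> (A *v x)"
    using continuous_attains_inf [of ?K] by blast
  \<comment> \<open>Since the minimum is attained at \<open>v\<close>, the strict gap at
    \<open>v\<close> makes the shifted form strictly negative off the plane. The sphere is non-empty
    because \<open>d\<close> is at least 1.\<close>
  define c where "c = v \<bullet> (A *v v)"
  define B where "B = A - c *\<^sub>R mat 1"
  have B: "B *v x = A *v x - c *\<^sub>R x" for x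
    by (simp add: B_def matrix_vector_mult_diff_rdistrib scaleR_matrix_vector_assoc [symmetric])
  have unit: "x \<bullet> (B *v x) = (norm x)\<^sup>2 * (y \<bullet> (A *v y) - c)" "norm y = 1"
    if "x \<noteq> 0" "y = x /\<^sub>R norm x" for x y
  proof -
    have "x = norm x *\<^sub>R y"
      using that by simp
    then have "x \<bullet> (A *v x) = (norm x)\<^sup>2 * (y \<bullet> (A *v y))"
      by (metis inner_scaleR_left inner_scaleR_right matrix_vector_mult_scaleR mult.assoc power2_eq_square)
    then show "x \<bullet> (B *v x) = (norm x)\<^sup>2 * (y \<bullet> (A *v y) - c)"
      by (simp add: B inner_diff_right power2_norm_eq_inner right_diff_distrib)
    show "norm y = 1"
      using that by simp
  qed
  have BS: "x \<bullet> (B *v x) \<ge> 0" if "x \<in> span S" for x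
  proof (cases "x = 0")
    case False
    show ?thesis
      unfolding unit(1) [OF False refl]
      using that False vmin [of "x /\<^sub>R norm x"] by (simp add: c_def span_scale)
  qed simp
  have BS': "x \<bullet> (B *v x) < 0" if "x \<noteq> 0" "\<And>y. y \<in> span S \<Longrightarrow> y \<bullet> x = 0" for x
  proof -
    have "(x /\<^sub>R norm x) \<bullet> (A *v (x /\<^sub>R norm x)) < c"
      unfolding c_def by (rule quadratic_form_gap [OF S(1) near]) (use v that in \<open>auto simp: inner_commute\<close>)
    then show ?thesis
      unfolding unit(1) [OF that(1) refl] using that(1) by (simp add: mult_less_0_iff)
  qed
  \<comment> \<open>Subtracting a multiple of the identity leaves mixed terms of orthogonal vectors
    unchanged, so the form of \<open>B\<close> splits along \<open>span T\<close> and its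
    complement.\<close>
  have cross: "x \<bullet> (B *v y) + y \<bullet> (B *v x) = 0" if "x \<in> span T" "\<And>x. x \<in> span T \<Longrightarrow> y \<bullet> x = 0" for x y
    using maximal_cross [OF T max that] that by (simp add: B inner_diff_right inner_commute)
  have split: "(x + y) \<bullet> (B *v (x + y)) = x \<bullet> (B *v x) + y \<bullet> (B *v y)"
    if "x \<in> span T" "\<And>x. x \<in> span T \<Longrightarrow> y \<bullet> x = 0" for x y
    using cross [OF that] by (simp add: matrix_vector_right_distrib inner_add_left inner_add_right)
  have order: "f \<bullet> (B *v f) \<le> e \<bullet> (B *v e)"
    if "e \<in> span T" "norm e = 1" "\<And>x. x \<in> span T \<Longrightarrow> f \<bullet> x = 0" "norm f = 1" for e f
    using maximal_order [OF T max that] that by (simp add: B inner_diff_right norm_eq_1)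
  have decomp: "proj_matrix T *v x \<in> span T" "\<And>y. y \<in> span T \<Longrightarrow> (x - proj_matrix T *v x) \<bullet> y = 0" for x
    using proj_matrix_in_span proj_matrix_residual [OF T(1)] by blast+
  \<comment> \<open>If the form were negative at \<open>e\<close>, by \<open>order\<close> it would
    be negative on the complement of \<open>span T\<close> too, hence on the sum of that complement
    and the line of \<open>e\<close>. This sum is the complement of the span of \<open>Z\<close>, of
    dimension \<open>d - 1\<close>, so it meets \<open>span S\<close>, where the form is
    nonnegative.\<close>
  have BT: "e \<bullet> (B *v e) \<ge> 0" if e: "e \<in> span T" "norm e = 1" for e
  proof (rule ccontr)
    assume neg: "\<not> e \<bullet> (B *v e) \<ge> 0"
    obtain Z where Z: "orthonormal (insert e Z)" "e \<notin> Z" "span (insert e Z) = span T"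
      "span Z = {y\<in>span T. e \<bullet> y = 0}"
      by (rule orthonormal_basis_with [OF subspace_span e]) (rule that)
    have Zfin: "finite Z"
      using Z(1) by (simp add: orthonormal_def)
    have "card (insert e Z) = d"
      using dim_span_orthonormal [OF Z(1)] dim_span_orthonormal [OF T(1)] Z(3) T(2) by simp
    then have "card Z < d"
      using Zfin Z(2) by simp
    moreover have "dim (span Z) = card Z"
      by (rule dim_span_orthonormal) (use Z(1) orthonormal_subset in blast)
    ultimately have "dim (span Z) < dim (span S)"
      using dim_span_orthonormal [OF S(1)] S(2) by simp
    then obtain x where x: "x \<in> span S" "x \<noteq> 0" "\<And>z. z \<in> span Z \<Longrightarrow> z \<bullet> x = 0"
      by (rule exists_orthogonal_in_subspace [OF subspace_span subspace_span]) (rule that)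
    define p y where "p = proj_matrix T *v x" and "y = x - proj_matrix T *v x"
    have p: "p \<in> span T" and y: "\<And>z. z \<in> span T \<Longrightarrow> y \<bullet> z = 0" and xpy: "x = p + y"
      using decomp by (auto simp: p_def y_def)
    \<comment> \<open>The component of \<open>p\<close> in \<open>span Z\<close>; as
      \<open>x\<close> is orthogonal to it, it vanishes and \<open>p\<close> is a multiple of
      \<open>e\<close>.\<close>
    let ?r = "p - (e \<bullet> p) *\<^sub>R e"
    have r: "?r \<in> span Z"
      unfolding Z(4) using p e by (simp add: span_diff span_scale inner_diff_right norm_eq_1)
    moreover have "y \<bullet> ?r = 0"
      using r Z(4) y by blast
    moreover have "e \<bullet> ?r = 0"
      using r Z(4) by blast
    ultimately have "p \<bullet> ?r - (e \<bullet> p) * (e \<bullet> ?r) = 0"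
      using x(3) [OF r] by (simp only: xpy inner_add_right inner_commute [of ?r])
    then have "?r \<bullet> ?r = 0"
      by (simp only: inner_diff_left inner_scaleR_left)
    then have pe: "p = (e \<bullet> p) *\<^sub>R e" by simp
    have Bp: "p \<bullet> (B *v p) = (e \<bullet> p)\<^sup>2 * (e \<bullet> (B *v e))"
      by (subst (1 2) pe) (simp add: matrix_vector_mult_scaleR power2_eq_square)
    have By: "y \<bullet> (B *v y) < 0" if "y \<noteq> 0"
    proof -
      have "(y /\<^sub>R norm y) \<bullet> (B *v (y /\<^sub>R norm y)) < 0"
        using order [OF e, of "y /\<^sub>R norm y"] y that neg by simp
      then show ?thesis
        using that by (simp add: matrix_vector_mult_scaleR mult_less_0_iff zero_less_mult_iff)
    qed
    have "x \<bullet> (B *v x) < 0"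
    proof (cases "y = 0")
      case True
      then have "e \<bullet> p \<noteq> 0"
        using pe xpy x(2) by auto
      then show ?thesis
        using neg True Bp xpy by (simp add: mult_less_0_iff)
    next
      case False
      have "p \<bullet> (B *v p) \<le> 0"
        using neg Bp by (simp add: mult_le_0_iff)
      then show ?thesis
        using split [OF p y] By [OF False] xpy by simp
    qed
    with BS [OF x(1)] show False by simp
  qed
  \<comment> \<open>The opposite count: otherwise the form is nonnegative on a space of dimension
    \<open>d + 1\<close>, which contains a nonzero vector orthogonal to \<open>span S\<close>, where
    the form is negative.\<close>
  have BT': "f \<bullet> (B *v f) < 0" if f: "\<And>x. x \<in> span T \<Longrightarrow> f \<bullet> x = 0" "norm f = 1" for f
  proof (rule ccontr)
    assume pos: "\<not> f \<bullet> (B *v f) < 0"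
    have fT: "orthonormal (insert f T)" "f \<notin> T"
      using orthonormal_insert [OF T(1) f(2)] f(1) span_base by blast+
    then have "dim (span (insert f T)) = Suc d"
      using dim_span_orthonormal [OF fT(1)] T by (simp add: orthonormal_def)
    then have "dim (span S) < dim (span (insert f T))"
      using dim_span_orthonormal [OF S(1)] S(2) by simp
    then obtain x where x: "x \<in> span (insert f T)" "x \<noteq> 0" "\<And>z. z \<in> span S \<Longrightarrow> z \<bullet> x = 0"
      by (rule exists_orthogonal_in_subspace [OF subspace_span subspace_span]) (rule that)
    obtain k where k: "x - k *\<^sub>R f \<in> span T"
      using x(1) by (auto simp: span_insert)
    define p where "p = x - k *\<^sub>R f"
    have p: "p \<in> span T" and x_eq: "x = p + k *\<^sub>R f"
      using k by (auto simp: p_def)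
    have "p \<bullet> (B *v p) \<ge> 0"
    proof (cases "p = 0")
      case False
      then have "0 \<le> (p /\<^sub>R norm p) \<bullet> (B *v (p /\<^sub>R norm p))"
        by (intro BT) (auto simp: p span_scale)
      then show ?thesis
        using False by (simp add: matrix_vector_mult_scaleR zero_le_mult_iff zero_le_divide_iff)
    qed simp
    moreover have "x \<bullet> (B *v x) = p \<bullet> (B *v p) + k\<^sup>2 * (f \<bullet> (B *v f))"
      unfolding x_eq
      by (subst split [OF p]) (simp_all add: f matrix_vector_mult_scaleR power2_eq_square)
    ultimately have "x \<bullet> (B *v x) \<ge> 0"
      using pos by simp
    with BS' [OF x(2,3)] show False by simp
  qed
  have BTn: "x \<bullet> (B *v x) \<ge> 0" if "x \<in> span T" for x
  proof (cases "x = 0")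
    case False
    then have "0 \<le> (x /\<^sub>R norm x) \<bullet> (B *v (x /\<^sub>R norm x))"
      by (intro BT) (auto simp: that span_scale)
    then show ?thesis
      using False by (simp add: matrix_vector_mult_scaleR zero_le_mult_iff zero_le_divide_iff)
  qed simp
  have BTn': "x \<bullet> (B *v x) < 0" if "\<And>y. y \<in> span T \<Longrightarrow> x \<bullet> y = 0" "x \<noteq> 0" for x
  proof -
    have "(x /\<^sub>R norm x) \<bullet> (B *v (x /\<^sub>R norm x)) < 0"
      by (rule BT') (use that in auto)
    then show ?thesis
      using that(2) by (simp add: matrix_vector_mult_scaleR mult_less_0_iff zero_less_mult_iff)
  qed
  let ?P = "proj_matrix T"
  \<comment> \<open>The compression of \<open>B\<close> to \<open>span T\<close> has a nonnegative
    form, and its trace is already carried by \<open>T\<close>.\<close>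
  define N where "N = ?P ** B ** ?P"
  have N: "x \<bullet> (N *v x) = (?P *v x) \<bullet> (B *v (?P *v x))" for x
    by (simp add: N_def matrix_vector_mul_assoc [symmetric] proj_matrix_sym)
  \<comment> \<open>Both sides are partial traces of \<open>N\<close>: the right one is the full
    trace, and the left one omits the nonnegative part over the complement of
    \<open>U\<close>.\<close>
  have trace: "(\<Sum>u\<in>U. (?P *v u) \<bullet> (B *v (?P *v u))) \<le> (\<Sum>t\<in>T. t \<bullet> (B *v t))"
  proof -
    obtain C where C: "proj_matrix U + proj_matrix C = mat 1"
      by (rule orthonormal_complement [OF U(1)]) (rule that)
    obtain D where D: "\<And>c s. c \<in> D \<Longrightarrow> s \<in> span T \<Longrightarrow> s \<bullet> c = 0" "proj_matrix T + proj_matrix D = mat 1"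
      by (rule orthonormal_complement [OF T(1)]) (rule that)
    have "?P *v c = 0" if "c \<in> D" for c
      using D(1) [OF that] by (intro proj_matrix_orthogonal) (simp add: span_base)
    then have "N \<bullet> proj_matrix D = 0"
      by (simp add: inner_proj_matrix N)
    then have "N \<bullet> proj_matrix T = N \<bullet> proj_matrix U + N \<bullet> proj_matrix C"
      by (metis C D(2) inner_add_right add.right_neutral)
    moreover have "0 \<le> N \<bullet> proj_matrix C"
      unfolding inner_proj_matrix N by (intro sum_nonneg BTn proj_matrix_in_span)
    moreover have "N \<bullet> proj_matrix T = (\<Sum>t\<in>T. t \<bullet> (B *v t))"
      unfolding inner_proj_matrix N by (rule sum.cong) (simp_all add: proj_matrix_span [OF T(1)] span_base)
    ultimately show ?thesis
      by (simp add: inner_proj_matrix N)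
  qed
  have sums: "(\<Sum>u\<in>V. u \<bullet> (B *v u)) = A \<bullet> proj_matrix V - c * card V" if "orthonormal V" for V
  proof -
    have "(\<Sum>u\<in>V. u \<bullet> (B *v u)) = (\<Sum>u\<in>V. u \<bullet> (A *v u) - c)"
      by (rule sum.cong) (use that in \<open>auto simp: B inner_diff_right orthonormal_def\<close>)
    then show ?thesis
      by (simp add: inner_proj_matrix sum_subtractf)
  qed
  \<comment> \<open>The form at the residual of \<open>u\<close>. It is nonpositive for each
    \<open>u\<close>, while the tie between \<open>U\<close> and \<open>T\<close> together with
    \<open>trace\<close> makes the sum nonnegative. So every term is 0, and strict negativity leaves
    no residual.\<close>
  let ?r = "\<lambda>u. (u - ?P *v u) \<bullet> (B *v (u - ?P *v u))"
  have "(\<Sum>u\<in>U. u \<bullet> (B *v u)) = (\<Sum>u\<in>U. (?P *v u) \<bullet> (B *v (?P *v u)) + ?r u)"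
  proof (rule sum.cong)
    fix u show "u \<bullet> (B *v u) = (?P *v u) \<bullet> (B *v (?P *v u)) + ?r u"
      using split [OF decomp, of u u] by simp
  qed simp
  moreover have "(\<Sum>u\<in>U. u \<bullet> (B *v u)) = (\<Sum>t\<in>T. t \<bullet> (B *v t))"
    by (simp add: sums U T eq)
  ultimately have r0: "0 \<le> (\<Sum>u\<in>U. ?r u)"
    using trace by (simp add: sum.distrib)
  have rle: "?r u \<le> 0" for u
    using BTn' [OF decomp(2), of u] by (cases "u - ?P *v u = 0") auto
  have "(\<Sum>u\<in>U. - ?r u) = 0"
    using r0 sum_nonpos [of U ?r] rle by (simp add: sum_negf)
  then have "?r u = 0" if "u \<in> U" for u
    using sum_nonneg_eq_0_iff [of U "\<lambda>u. - ?r u"] U(1) rle that by (auto simp: orthonormal_def)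
  then have "u - ?P *v u = 0" if "u \<in> U" for u
    using BTn' [OF decomp(2), of u] that by fastforce
  then have "U \<subseteq> span T"
    using proj_matrix_in_span by (metis eq_iff_diff_eq_0 subsetI)
  then have "span U \<subseteq> span T"
    by (rule span_minimal) simp
  then have "span U = span T"
    using dim_span_orthonormal [OF U(1)] dim_span_orthonormal [OF T(1)] U(2) T(2)
    by (intro subspace_dim_equal) auto
  then show ?thesis
    by (rule proj_matrix_cong [OF U(1) T(1)])
qed

lemma medial_axis_grassmannian_far:
  fixes P :: "real^'m^'m"
  assumes P: "P \<in> grassmannian d" and d: "1 \<le> d" and A: "A \<in> medial_axis (grassmannian d)"
  shows "sqrt 2 / 2 \<le> dist P A"
proof (rule ccontr)
  assume "\<not> sqrt 2 / 2 \<le> dist P A"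
  moreover obtain S where S: "orthonormal S" "card S = d" "P = proj_matrix S"
    using P by (auto simp: grassmannian_iff)
  ultimately have near: "dist A (proj_matrix S) < sqrt 2 / 2"
    by (simp add: dist_commute)
  obtain Q R where QR: "Q \<in> grassmannian d" "R \<in> grassmannian d" "Q \<noteq> R"
    and Q: "\<forall>P\<in>grassmannian d. dist A Q \<le> dist A P" and R: "\<forall>P\<in>grassmannian d. dist A R \<le> dist A P"
    using A by (auto simp: medial_axis_def)
  obtain T U where T: "orthonormal T" "card T = d" "Q = proj_matrix T"
    and U: "orthonormal U" "card U = d" "R = proj_matrix U"
    using QR(1,2) by (auto simp: grassmannian_iff)
  have Qmax: "A \<bullet> P \<le> A \<bullet> Q" if "P \<in> grassmannian d" for P
    using Q dist_grassmannian_le_iff [OF QR(1) that] that by blast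
  have Rmax: "A \<bullet> P \<le> A \<bullet> R" if "P \<in> grassmannian d" for P
    using R dist_grassmannian_le_iff [OF QR(2) that] that by blast
  have "A \<bullet> R = A \<bullet> Q"
    using Qmax [OF QR(2)] Rmax [OF QR(1)] by simp
  then have "R = Q"
    unfolding T(3) U(3)
    by (intro maximizer_unique [OF S(1,2) d near T(1,2) _ U(1,2)]) (use Qmax T(3) in auto)
  with QR(3) show False by simp
qed

lemma infdist_medial_axis_grassmannian:
  fixes P :: "real^'m^'m"
  assumes P: "P \<in> grassmannian d" and d: "1 \<le> d" "d < CARD('m)"
  shows "infdist P (medial_axis (grassmannian d)) = sqrt 2 / 2"
proof -
  obtain A where A: "A \<in> medial_axis (grassmannian d)" "dist P A = sqrt 2 / 2"
    by (rule medial_axis_grassmannian_near [OF P d]) (rule that)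
  have "infdist P (medial_axis (grassmannian d)) \<le> sqrt 2 / 2"
    using infdist_le [OF A(1), of P] A(2) by simp
  moreover have "sqrt 2 / 2 \<le> (INF a\<in>medial_axis (grassmannian d). dist P a)"
    using A(1) medial_axis_grassmannian_far [OF P d(1)] by (intro cINF_greatest) auto
  then have "sqrt 2 / 2 \<le> infdist P (medial_axis (grassmannian d))"
    using A(1) by (auto simp: infdist_def)
  ultimately show ?thesis by simp
qed

lemma t_max_eq:
  fixes M :: "((real^'n) \<times> (real^'m^'m)) set"
  assumes "M \<noteq> {}" "snd ` M \<subseteq> grassmannian d" and d: "1 \<le> d" "d < CARD('m)"
  shows "t_max \<gamma> d M = sqrt 2 / 2 * \<gamma>"
proof -
  have "(INF e\<in>M. infdist (snd e) (medial_axis (grassmannian d))) = (INF e\<in>M. sqrt 2 / 2)"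
    by (intro INF_cong refl infdist_medial_axis_grassmannian d) (use assms(2) in auto)
  then show ?thesis
    using assms(1) by (simp add: t_max_def)
qed

section \<open>Thickenings below the reach\<close>

text \<open>The gauge \<open>N\<close> is a plain continuous function, so that
  \<open>norm_gamma\<close>, which is not the norm of its type, is covered. Uniqueness identifies
  the graph with a set cut out by closed conditions.\<close>

lemma continuous_on_nearest_point:
  fixes N :: "'a::euclidean_space \<Rightarrow> real"
  assumes S: "compact S" and N: "continuous_on UNIV N"
    and r: "\<And>x. x \<in> T \<Longrightarrow> r x \<in> S" "\<And>x y. x \<in> T \<Longrightarrow> y \<in> S \<Longrightarrow> N (x - r x) \<le> N (x - y)"
    and unique: "\<And>x y. x \<in> T \<Longrightarrow> y \<in> S \<Longrightarrow> (\<And>z. z \<in> S \<Longrightarrow> N (x - y) \<le> N (x - z)) \<Longrightarrow> y = r x"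
  shows "continuous_on T r"
proof -
  \<comment> \<open>The graph of \<open>r\<close> is closed, and \<open>S\<close> is compact.\<close>
  let ?C = "(UNIV \<times> S) \<inter> (\<Inter>z\<in>S. {p. N (fst p - snd p) \<le> N (fst p - z)})"
  have "closed ?C"
    by (intro closed_Int closed_Times closed_UNIV compact_imp_closed [OF S] closed_INT ballI
        closed_Collect_le continuous_on_compose2 [OF N] continuous_intros) auto
  then have "closedin (top_of_set (T \<times> S)) ((T \<times> S) \<inter> ?C)"
    by (rule closedin_closed_Int)
  moreover have "(T \<times> S) \<inter> ?C = (\<lambda>x. (x, r x)) ` T"
    using r unique by (auto simp: image_iff)
  ultimately show ?thesis
    using continuous_closed_graph_eq [OF S, of r T] r(1) by (auto simp: Pi_iff)
qed

section \<open>The weighted norm and retraction of thickenings\<close>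

lemma norm_gamma_nonneg: "0 \<le> norm_gamma \<gamma> e"
  by (simp add: norm_gamma_def case_prod_unfold)

lemma norm_gamma_scaleR: "norm_gamma \<gamma> (a *\<^sub>R e) = \<bar>a\<bar> * norm_gamma \<gamma> e"
proof -
  have "(norm (a *\<^sub>R fst e))\<^sup>2 + \<gamma>\<^sup>2 * (norm (a *\<^sub>R snd e))\<^sup>2
      = a\<^sup>2 * ((norm (fst e))\<^sup>2 + \<gamma>\<^sup>2 * (norm (snd e))\<^sup>2)"
    by (simp add: power_mult_distrib algebra_simps)
  then show ?thesis
    by (simp add: norm_gamma_def case_prod_unfold real_sqrt_mult)
qed

lemma continuous_on_norm_gamma: "continuous_on UNIV (norm_gamma \<gamma>)"
  unfolding norm_gamma_def case_prod_unfold by (intro continuous_intros)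

lemma infdist_gamma_le: "x \<in> S \<Longrightarrow> infdist_gamma \<gamma> e S \<le> norm_gamma \<gamma> (e - x)"
  unfolding infdist_gamma_def
  by (rule cINF_lower) (auto intro: bdd_belowI2 norm_gamma_nonneg)

lemma subset_thickening: "0 \<le> t \<Longrightarrow> S \<subseteq> thickening \<gamma> S t"
proof
  fix x assume "0 \<le> t" "x \<in> S"
  then show "x \<in> thickening \<gamma> S t"
    using infdist_gamma_le [of x S \<gamma> x] norm_gamma_scaleR [of \<gamma> 0 x] by (simp add: thickening_def)
qed

lemma thickening_retraction:
  assumes S: "compact S" "S \<noteq> {}" and t: "0 \<le> t" "ereal t < reach \<gamma> S"
  obtains r where "continuous_on (thickening \<gamma> S t) r" "r ` thickening \<gamma> S t \<subseteq> S"
    "\<And>x. x \<in> S \<Longrightarrow> r x = x"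
    "homotopic_with_canon (\<lambda>_. True) (thickening \<gamma> S t) (thickening \<gamma> S t) r id"
proof -
  let ?near = "\<lambda>e x. x \<in> S \<and> (\<forall>y\<in>S. norm_gamma \<gamma> (e - x) \<le> norm_gamma \<gamma> (e - y))"
  let ?T = "thickening \<gamma> S t"
  define r where "r e = (THE x. ?near e x)" for e
  \<comment> \<open>Strict inequality with the supremum leaves room for a radius above
    \<open>t\<close>, which turns the closed condition defining the thickening into the open one in
    \<open>reach\<close>.\<close>
  obtain \<rho> where \<rho>: "t < \<rho>" "\<And>e. infdist_gamma \<gamma> e S < \<rho> \<Longrightarrow> \<exists>!x. ?near e x"
    using t(2) unfolding reach_def less_Sup_iff by auto
  have ex1: "\<exists>!x. ?near e x" if "e \<in> ?T" for e
    using that \<rho> by (auto simp: thickening_def)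
  have r: "?near e (r e)" if "e \<in> ?T" for e
    unfolding r_def by (rule theI' [OF ex1 [OF that]])
  have r_unique: "x = r e" if "e \<in> ?T" "?near e x" for e x
    using ex1 [OF that(1)] r [OF that(1)] that(2) by blast
  have cont: "continuous_on ?T r"
    by (rule continuous_on_nearest_point [OF S(1) continuous_on_norm_gamma [of \<gamma>]])
       (use r r_unique in blast)+
  \<comment> \<open>Moving from \<open>e\<close> towards \<open>r e\<close> only shrinks the
    difference to \<open>r e\<close>, so homogeneity of the norm keeps the segment within
    \<open>t\<close> of that single point of \<open>S\<close>.\<close>
  have segment: "closed_segment (r e) e \<subseteq> ?T" if e: "e \<in> ?T" for e
  proof
    fix z assume "z \<in> closed_segment (r e) e"
    then obtain a where a: "0 \<le> a" "a \<le> 1" and z: "z = (1 - a) *\<^sub>R r e + a *\<^sub>R e"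
      by (auto simp: closed_segment_def)
    have "z - r e = a *\<^sub>R (e - r e)"
      by (simp add: z algebra_simps)
    then have "norm_gamma \<gamma> (z - r e) \<le> norm_gamma \<gamma> (e - r e)"
      using a by (simp add: norm_gamma_scaleR mult_left_le_one_le norm_gamma_nonneg)
    also have "\<dots> \<le> infdist_gamma \<gamma> e S"
      unfolding infdist_gamma_def using r [OF e] S(2) by (intro cINF_greatest) auto
    also have "\<dots> \<le> t"
      using e by (simp add: thickening_def)
    finally show "z \<in> ?T"
      using infdist_gamma_le [of "r e" S \<gamma> z] r [OF e] by (simp add: thickening_def)
  qed
  show thesis
  proof
    show "continuous_on ?T r" by (rule cont)
    show "r ` ?T \<subseteq> S" using r by auto
    show "homotopic_with_canon (\<lambda>_. True) ?T ?T r id"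
      by (rule homotopic_with_linear [OF cont]) (auto simp: id_def intro: subsetD [OF segment])
    fix x assume x: "x \<in> S"
    have "?near x x"
      using x norm_gamma_scaleR [of \<gamma> 0 x] by (simp add: norm_gamma_nonneg)
    moreover have "x \<in> ?T"
      using subset_thickening [OF t(1)] x by blast
    ultimately show "r x = x"
      using r_unique by metis
  qed
qed

text \<open>The left inverse of \<open>f\<close> is \<open>h \<circ> r\<close>: retract to the
  image, then undo the embedding. Composed with \<open>f\<close> it gives back \<open>r\<close>,
  which is homotopic to the identity.\<close>

lemma cohomology_iso_thickening:
  assumes X: "compact_space X" "topspace X \<noteq> {}" and f: "embedding_map X euclidean f"
    and t: "0 \<le> t" "ereal t < reach \<gamma> (f ` topspace X)"
  shows "continuous_map X (top_of_set (thickening \<gamma> (f ` topspace X) t)) f"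
    and "cohomology_iso (top_of_set (thickening \<gamma> (f ` topspace X) t)) X (\<lambda>j. cohomology_pullback j X f)"
proof -
  let ?M = "f ` topspace X"
  let ?T = "thickening \<gamma> ?M t"
  obtain h where h: "homeomorphic_maps X (top_of_set ?M) f h"
    using f by (auto simp: embedding_map_def homeomorphic_map_maps)
  then have cf: "continuous_map X (top_of_set ?M) f" and ch: "continuous_map (top_of_set ?M) X h"
    and hf: "\<And>x. x \<in> topspace X \<Longrightarrow> h (f x) = x" and fh: "\<And>y. y \<in> ?M \<Longrightarrow> f (h y) = y"
    by (auto simp: homeomorphic_maps_def)
  have "compactin (top_of_set ?M) ?M"
    using image_compactin [OF _ cf, of "topspace X"] X(1) by (simp add: compact_space_def)
  then have "compact ?M"
    by (simp add: compactin_subtopology)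
  then obtain r where r: "continuous_on ?T r" "r ` ?T \<subseteq> ?M" "\<And>x. x \<in> ?M \<Longrightarrow> r x = x"
    and hom: "homotopic_with_canon (\<lambda>_. True) ?T ?T r id"
    by (rule thickening_retraction [OF _ _ t]) (use X(2) in auto)
  show c: "continuous_map X (top_of_set ?T) f"
    using cf subset_thickening [OF t(1), of ?M \<gamma>] by (auto simp: continuous_map_in_subtopology)
  have cr: "continuous_map (top_of_set ?T) (top_of_set ?M) r"
    using r by (auto simp: continuous_map_in_subtopology)
  show "cohomology_iso (top_of_set ?T) X (\<lambda>j. cohomology_pullback j X f)"
  proof (rule cohomology_iso_section_deformation [OF c continuous_map_compose [OF cr ch]])
    show "(h \<circ> r) (f x) = x" if "x \<in> topspace X" for x
      using that r(3) hf by simp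
    show "homotopic_with_canon (\<lambda>_. True) ?T ?T (f \<circ> (h \<circ> r)) id"
    proof (rule homotopic_with_eq [OF hom])
      fix e assume "e \<in> topspace (top_of_set ?T)"
      then have "r e \<in> ?M"
        using r(2) by auto
      then show "(f \<circ> (h \<circ> r)) e = r e"
        by (simp only: o_apply fh)
    qed auto
  qed
qed

theorem theorem3p6:
  fixes X :: "'a topology" and k d :: nat and \<A> :: "'a chart set"
    and u :: "'a \<Rightarrow> real^'n" and p :: "'a \<Rightarrow> real^'m^'m" and \<gamma> :: real
    and M :: "((real^'n) \<times> (real^'m^'m)) set"
  assumes "1 \<le> d" and "d \<le> CARD('m) - 1"
    and "topspace X \<noteq> {}" and "compact_C3_manifold X k \<A>"
    and "C3_immersion k \<A> u"
    and "continuous_map X (top_of_set (grassmannian d)) p"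
    and "embedding_map X euclidean (lift u p)"
    and "\<gamma> > 0"
    and "M = lift u p ` topspace X"
  shows "t_max \<gamma> d M = sqrt 2 / 2 * \<gamma> \<and>
    (\<forall>t::real. 0 \<le> t \<and> ereal t < min (reach \<gamma> M) (ereal (t_max \<gamma> d M)) \<longrightarrow>
       cohomology_iso (top_of_set (thickening \<gamma> M t)) X
         (\<lambda>j. cohomology_pullback j X (id \<circ> lift u p)) \<and>
       (\<forall>i\<in>{1..d}. cohomology_pullback i X (id \<circ> lift u p) (persistent_stiefel_whitney \<gamma> d i M t)
                   = bundle_stiefel_whitney d i X p))"
proof (intro conjI allI impI ballI)
  let ?f = "lift u p"
  have pG: "p x \<in> grassmannian d" if "x \<in> topspace X" for x
    using assms(6) that by (auto simp: continuous_map_def)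
  show "t_max \<gamma> d M = sqrt 2 / 2 * \<gamma>"
    using assms(1-3) pG by (intro t_max_eq) (auto simp: assms(9) lift_def)
  fix t assume t: "0 \<le> t \<and> ereal t < min (reach \<gamma> M) (ereal (t_max \<gamma> d M))"
  have "compact_space X"
    using assms(4) by (simp add: compact_C3_manifold_def)
  then have cont: "continuous_map X (top_of_set (thickening \<gamma> M t)) ?f"
    and iso: "cohomology_iso (top_of_set (thickening \<gamma> M t)) X (\<lambda>j. cohomology_pullback j X ?f)"
    using cohomology_iso_thickening [of X ?f t \<gamma>] assms(3,7) t by (auto simp: assms(9))
  \<comment> \<open>The factor \<open>id\<close> is the inclusion of the lift into its
    thickening.\<close>
  show "cohomology_iso (top_of_set (thickening \<gamma> M t)) X (\<lambda>j. cohomology_pullback j X (id \<circ> ?f))"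
    using iso by simp
  fix i assume "i \<in> {1..d}"
  have "(filtration_map d \<circ> ?f) x = p x" if "x \<in> topspace X" for x
    using pG [OF that] by (simp add: filtration_map_def lift_def closest_point_self)
  then show "cohomology_pullback i X (id \<circ> ?f) (persistent_stiefel_whitney \<gamma> d i M t)
      = bundle_stiefel_whitney d i X p"
    unfolding persistent_stiefel_whitney_def bundle_stiefel_whitney_def id_comp
      cohomology_pullback_compose [OF cont]
    by (rule cohomology_pullback_cong)
qed

end
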